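(* Suppose $f$ is twice continuously differentiable with Lipschitz continuous gradient $\nabla f$. Then there exist two constants $\bar\alpha>0$ and $\rho_1>0$, both independent of $k$, such that for the iterates $x_k$ and directions $d(x_k)$ of Algorithm RPN-CG (defined in the context, run with this $\rho_1$ as line search parameter) the sufficient descent condition $$F(R_{x_k}(\alpha d(x_k)))\le F(x_k)-\alpha\rho_1\|d(x_k)\|_F^2$$ holds for all $\alpha\in(0,\bar\alpha)$ and all $k$. Therefore, the step size $\alpha_k$ accepted by the backtracking line search satisfies $\alpha_k\ge\bar\alpha\rho_2$ for all $k$.
   Context: Setting. $\mathbb R^n$ carries the Euclidean inner product $\langle\cdot,\cdot\rangle$ and norm $\|\cdot\|_F$. $\mathcal M\subset\mathbb R^n$ is a compact embedded submanifold with the induced Riemannian metric; $c=n-\dim\mathcal M$; $T_x\mathcal M$, $N_x\mathcal M$ are tangent and normal spaces; $P_L$ is the orthogonal projection onto a subspace $L$. $F=f+h$ with $h(x)=\mu\|x\|_1$, $\mu>0$, $f:\mathbb R^n\to\mathbb R$ with Euclidean gradient $\nabla f$ and Hessian $\nabla^2f$. $R$ is a retraction: a smooth map $T\mathcal M\to\mathcal M$ with $R_x(0_x)=x$, $\mathrm D R_x(0_x)=\mathrm{id}$. $B_x\in\mathbb R^{n\times c}$ has as columns an orthonormal basis of $N_x\mathcal M$, so $T_x\mathcal M=\{v:B_x^Tv=0\}$. The Weingarten map is $\mathcal W_x(w,u)=(\mathrm D(y\mapsto P_{T_y\mathcal M})(x)[w])u$ for $w\in T_x\mathcal M$, $u\in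 N_x\mathcal M$. Proximal gradient direction. For $t>0$, $v(x)=\arg\min_{v\in T_x\mathcal M} f(x)+\langle\nabla f(x),v\rangle+\frac1{2t}\|v\|_F^2+h(x+v)$, and $\lambda(x)\in\mathbb R^{c}$ is a Lagrange multiplier, i.e. $v(x)=\mathrm{prox}_{th}(x-t[\nabla f(x)+B_x\lambda(x)])-x$ with $\mathrm{prox}_{th}(z)=\max(|z|-t\mu,0)\odot\mathrm{sign}(z)$ and $B_x^Tv(x)=0$. Partition. Let $j$ be the number of nonzero entries of $x+v(x)$; order coordinates so these are the first $j$. For a vector or matrix $A$ with $n$ rows, $\bar A$ is its first $j$ rows and $\hat A$ its last $n-j$ rows. $\mathcal L_x(\cdot)=\mathcal W_x(\cdot,B_x\lambda(x))$, regarded as a symmetric operator on $\mathbb R^n$ by precomposition with $P_{T_x\mathcal M}$; $\mathfrak B_x=\nabla^2f(x)-\mathcal L_x=\begin{pmatrix}\mathcal B_x&\mathfrak B_x^{(12)}\\ \mathfrak B_x^{(21)}&\mathfrak B_x^{(22)}\end{pmatrix}$ with $\mathcal B_x\in\mathbb R^{j\times j}$. All these depend on $t$. Put $\ell_{x,t}=\frac1t(-I_j+t\mathcal B_x)\bar v(x)+\mathfrak B_x^{(12)}\hat v(x)$. Truncated CG (tCG). Parameters $\vartheta,\gamma,\tau,\theta>0$, $\kappa\in(0,1)$. $P_x=I_j-\bar B_x\bar B_x^\dagger$; $G_x(u)=f(x)+\langle\nabla f(x),u\rangle+\frac12\langle u,\mathfrak B_xu\rangle+\frac\tau2\|\hat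 u\|_F^2+h(x+u)$. Output $(w(x),\mathrm{status})$: (1) If $G_x(v(x))>G_x(0)$, return $w(x)=0$, status early1. (2) If $\langle v(x),\mathfrak B_xv(x)\rangle+\tau\|\hat v(x)\|_F^2<\gamma\|v(x)\|_F^2$, return $w(x)=0$, status early2. (3) $w_0=0$, $r_0=P_x\ell_{x,t}$, $o_0=-r_0$, $\delta_0=\langle r_0,r_0\rangle$. For $i=0,1,\dots$: $q_i=P_x\mathcal B_xo_i$; if $\langle o_i,q_i\rangle\le\vartheta\delta_i$, return $w(x)=w_i$, status neg. Set $\alpha_i=\langle r_i,r_i\rangle/\langle o_i,q_i\rangle$, $w_{i+1}=w_i+\alpha_io_i$, $r_{i+1}=r_i+\alpha_iq_i$, $d_{i+1}=\begin{pmatrix}\bar v(x)+w_{i+1}\\ \hat v(x)\end{pmatrix}$. If $\langle d_{i+1},\mathfrak B_xd_{i+1}\rangle+\tau\|\hat v(x)\|_F^2<\gamma\|d_{i+1}\|_F^2$ or $G_x(d_{i+1})>G_x(0)$, return $w(x)=w_i$, status early3. Set $\beta_{i+1}=\langle r_{i+1},r_{i+1}\rangle/\langle r_i,r_i\rangle$, $o_{i+1}=-r_{i+1}+\beta_{i+1}o_i$, $\delta_{i+1}=\langle r_{i+1},r_{i+1}\rangle+\beta_{i+1}^2\delta_i$. If $\|r_{i+1}\|_F\le\|r_0\|_F\min(\|r_0\|_F^\theta,\kappa)$, return $w(x)=w_{i+1}$ with status lin if $\|r_0\|_F^\theta>\kappa$ and sup otherwise. The search direction is $d(x)=\begin{pmatrix}\bar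 v(x)+w(x)\\ \hat v(x)\end{pmatrix}$. Algorithm RPN-CG. Parameters: $x_0\in\mathcal M$, $\alpha_{\mathrm{init}}>0$, $\rho_1,\rho_2\in(0,1)$, $t_{\max}\ge t_{\min}>0$, $t_0\in[t_{\min},t_{\max}]$, $\varpi_1>1$, $\varpi_2\in(0,1)$, and the tCG parameters. Set flag $=0$, $k=0$ and loop: (a) compute $v(x_k)$ with $t=t_k$, run tCG at $x_k$ with $t=t_k$, and form $d(x_k)$. (b) If $(4+1/t_k)\|d(x_k)\|_F<\|v(x_k)\|_F$ or status is early1, set $t_{k+1}=\max(\varpi_2t_k,t_{\min})$; else if status is not sup, set $t_{k+1}=\min(\varpi_1t_k,t_{\max})$; else $t_{k+1}=t_k$. (c) If status is not sup and flag $\ne1$: set flag $=0$, $\alpha_k=\alpha_{\mathrm{init}}$; while $F(R_{x_k}(\alpha_kd(x_k)))>F(x_k)-\alpha_k\rho_1\|d(x_k)\|_F^2$ replace $\alpha_k$ by $\rho_2\alpha_k$; set $x_{k+1}=R_{x_k}(\alpha_kd(x_k))$, $k\leftarrow k+1$. (d) Otherwise flag $\leftarrow$ flag $+1$. If flag $=1$: $x_{k+1}=R_{x_k}(d(x_k))$, $k\leftarrow k+1$. Else: $x_{k+1}=R_{x_k}(d(x_k))$, flag $=0$; if $F(x_{k+1})>F(x_{k-1})-\rho_1\|v(x_{k-1})\|_F^2$, backtrack at $x_{k-1}$: starting from $\alpha_{k-1}=\alpha_{\mathrm{init}}$, while $F(R_{x_{k-1}}(\alpha_{k-1}d(x_{k-1})))>F(x_{k-1})-\alpha_{k-1}\rho_1\|d(x_{k-1})\|_F^2$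 replace $\alpha_{k-1}$ by $\rho_2\alpha_{k-1}$, then overwrite $x_k=R_{x_{k-1}}(\alpha_{k-1}d(x_{k-1}))$ ($k$ unchanged); otherwise accept and $k\leftarrow k+1$. "Accepted step size" refers to the final $\alpha_k$ (resp. $\alpha_{k-1}$) of a backtracking loop in (c) or (d). *)

theory Defs
  imports "HOL-Analysis.Analysis"
begin

text \<open>Only meant for open sets. A function of class \<open>C\<close>-\<open>Suc k\<close> is one that is differentiable and whose
  directional derivatives are all of class \<open>C\<close>-\<open>k\<close>; in finite dimension this is the usual notion.\<close>

primrec Ck_on :: "nat \<Rightarrow> 'a::euclidean_space set \<Rightarrow> ('a \<Rightarrow> 'b::real_normed_vector) \<Rightarrow> bool" where
  "Ck_on 0 S g \<longleftrightarrow> continuous_on S g"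
| "Ck_on (Suc k) S g \<longleftrightarrow> (\<forall>x\<in>S. g differentiable (at x)) \<and>
     (\<forall>v. Ck_on k S (\<lambda>x. frechet_derivative g (at x) v))"

definition smooth_on :: "'a::euclidean_space set \<Rightarrow> ('a \<Rightarrow> 'b::real_normed_vector) \<Rightarrow> bool" where
  "smooth_on S g \<longleftrightarrow> (\<forall>k. Ck_on k S g)"

text \<open>For sets that need not be open, such as the tangent bundle.\<close>

definition smooth_map_on :: "'a::euclidean_space set \<Rightarrow> ('a \<Rightarrow> 'b::real_normed_vector) \<Rightarrow> bool" where
  "smooth_map_on S g \<longleftrightarrow>
     (\<forall>p\<in>S. \<exists>U e. open U \<and> p \<in> U \<and> smooth_on U e \<and> (\<forall>q \<in> U \<inter> S. e q = g q))"

text \<open>Slice charts: locally, an ambient diffeomorphism maps \<open>M\<close> onto an open piece of an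
  \<open>m\<close>-dimensional linear subspace.\<close>

definition embedded_submanifold :: "nat \<Rightarrow> 'a::euclidean_space set \<Rightarrow> bool" where
  "embedded_submanifold m M \<longleftrightarrow>
     (\<forall>x\<in>M. \<exists>U V \<phi> \<psi> L. open (U :: 'a set) \<and> x \<in> U \<and> open (V :: 'a set) \<and>
        homeomorphism U V \<phi> \<psi> \<and> smooth_on U \<phi> \<and> smooth_on V \<psi> \<and>
        subspace L \<and> dim L = m \<and> \<phi> ` (U \<inter> M) = V \<inter> L)"

definition tangent_space :: "'a::euclidean_space set \<Rightarrow> 'a \<Rightarrow> 'a set" where
  "tangent_space M x =
     {v. \<exists>\<epsilon>>0. \<exists>\<gamma>. smooth_on {-\<epsilon><..<\<epsilon>::real} \<gamma> \<and> \<gamma> ` {-\<epsilon><..<\<epsilon>} \<subseteq> M \<and> \<gamma> 0 = x \<and>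
        (\<gamma> has_vector_derivative v) (at 0)}"

definition normal_space :: "'a::euclidean_space set \<Rightarrow> 'a \<Rightarrow> 'a set" where
  "normal_space M x = orthogonal_comp (tangent_space M x)"

definition tangent_bundle :: "'a::euclidean_space set \<Rightarrow> ('a \<times> 'a) set" where
  "tangent_bundle M = (SIGMA x:M. tangent_space M x)"

definition manifold_retraction ::
  "'a::euclidean_space set \<Rightarrow> ('a \<Rightarrow> 'a \<Rightarrow> 'a) \<Rightarrow> bool" where
  "manifold_retraction M R \<longleftrightarrow>
     smooth_map_on (tangent_bundle M) (\<lambda>(x, v). R x v) \<and>
     (\<forall>x\<in>M. (\<forall>v\<in>tangent_space M x. R x v \<in> M) \<and> R x 0 = x \<and>
        (R x has_derivative (\<lambda>u. u)) (at 0 within tangent_space M x))"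

definition orth_proj :: "'a::euclidean_space set \<Rightarrow> 'a \<Rightarrow> 'a" where
  "orth_proj L u = (THE p. p \<in> L \<and> u - p \<in> orthogonal_comp L)"

text \<open>The derivative relative to \<open>M\<close> is uniquely determined on tangent vectors, so the choice hidden in
  \<^const>\<open>frechet_derivative\<close> is immaterial for tangent \<open>w\<close>.\<close>

definition weingarten ::
  "(real^'n) set \<Rightarrow> real^'n \<Rightarrow> real^'n \<Rightarrow> real^'n \<Rightarrow> real^'n" where
  "weingarten M x w u =
     frechet_derivative (\<lambda>y. matrix (orth_proj (tangent_space M y))) (at x within M) w *v u"

definition orthonormal_normal_basis :: "(real^'n) set \<Rightarrow> real^'n \<Rightarrow> real^'c^'n \<Rightarrow> bool" where
  "orthonormal_normal_basis M x B \<longleftrightarrow>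
     transpose B ** B = mat 1 \<and> span (columns B) = normal_space M x"

text \<open>The multiplier \<open>mult\<close> takes the proximal parameter \<open>t\<close> as its first argument.\<close>

record ('n, 'c) rpn_problem =
  man :: "(real^'n) set"
  fsm :: "real^'n \<Rightarrow> real"
  grad :: "real^'n \<Rightarrow> real^'n"
  hess :: "real^'n \<Rightarrow> real^'n^'n"
  mu :: real
  retr :: "real^'n \<Rightarrow> real^'n \<Rightarrow> real^'n"
  nbas :: "real^'n \<Rightarrow> real^'c^'n"
  mult :: "real \<Rightarrow> real^'n \<Rightarrow> real^'c"

record rpn_params =
  ainit :: real
  rho2 :: real
  tmin :: real
  tmax :: real
  varpi1 :: real
  varpi2 :: real
  vartheta :: real
  gam :: real
  tau :: real
  theta :: real
  kappa :: real

definition hreg :: "('n::finite, 'c::finite) rpn_problem \<Rightarrow> real^'n \<Rightarrow> real" where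
  "hreg P x = mu P * (\<Sum>i\<in>UNIV. \<bar>x $ i\<bar>)"

definition Fobj :: "('n::finite, 'c::finite) rpn_problem \<Rightarrow> real^'n \<Rightarrow> real" where
  "Fobj P x = fsm P x + hreg P x"

definition prox :: "('n::finite, 'c::finite) rpn_problem \<Rightarrow> real \<Rightarrow> real^'n \<Rightarrow> real^'n" where
  "prox P t z = (\<chi> i. max (\<bar>z $ i\<bar> - t * mu P) 0 * sgn (z $ i))"

definition pg_dir :: "('n::finite, 'c::finite) rpn_problem \<Rightarrow> real \<Rightarrow> real^'n \<Rightarrow> real^'n" where
  "pg_dir P t x =
     arg_min_on (\<lambda>v. fsm P x + grad P x \<bullet> v + 1 / (2 * t) * (norm v)\<^sup>2 + hreg P (x + v))
       (tangent_space (man P) x)"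

definition is_multiplier ::
  "('n::finite, 'c::finite) rpn_problem \<Rightarrow> real \<Rightarrow> real^'n \<Rightarrow> real^'c \<Rightarrow> bool" where
  "is_multiplier P t x l \<longleftrightarrow>
     pg_dir P t x = prox P t (x - t *\<^sub>R (grad P x + nbas P x *v l)) - x \<and>
     transpose (nbas P x) *v pg_dir P t x = 0"

text \<open>Instead of reordering coordinates, we keep the index set \<open>J\<close> of the nonzero entries of
  \<open>x + v(x)\<close>. Subvectors and submatrices indexed by \<open>J\<close> (the bar part) or by its complement (the hat
  part) are represented by zero padding to full size; this preserves sums, products, transposes, inner
  products, norms and Moore--Penrose inverses. Only the identity of the smaller space needs care: it becomes
  \<open>block J J (mat 1)\<close>.\<close>

definition act_set :: "('n::finite, 'c::finite) rpn_problem \<Rightarrow> real \<Rightarrow> real^'n \<Rightarrow> 'n set" where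
  "act_set P t x = {i. (x + pg_dir P t x) $ i \<noteq> 0}"

definition part :: "'n set \<Rightarrow> ('a::zero)^'n \<Rightarrow> 'a^'n" where
  "part J a = (\<chi> i. if i \<in> J then a $ i else 0)"

definition block :: "'n set \<Rightarrow> 'm set \<Rightarrow> real^'m^'n \<Rightarrow> real^'m^'n" where
  "block I K A = (\<chi> i k. if i \<in> I \<and> k \<in> K then A $ i $ k else 0)"

definition moore_penrose_inverse :: "real^'m^'n \<Rightarrow> real^'n^'m" where
  "moore_penrose_inverse A = (THE X. A ** X ** A = A \<and> X ** A ** X = X \<and>
     transpose (A ** X) = A ** X \<and> transpose (X ** A) = X ** A)"

definition Lop :: "('n::finite, 'c::finite) rpn_problem \<Rightarrow> real \<Rightarrow> real^'n \<Rightarrow> real^'n \<Rightarrow> real^'n" where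
  "Lop P t x u =
     weingarten (man P) x (orth_proj (tangent_space (man P) x) u) (nbas P x *v mult P t x)"

definition Bfull :: "('n::finite, 'c::finite) rpn_problem \<Rightarrow> real \<Rightarrow> real^'n \<Rightarrow> real^'n^'n" where
  "Bfull P t x = hess P x - matrix (Lop P t x)"

definition B11 :: "('n::finite, 'c::finite) rpn_problem \<Rightarrow> real \<Rightarrow> real^'n \<Rightarrow> real^'n^'n" where
  "B11 P t x = (let J = act_set P t x in block J J (Bfull P t x))"

definition B12 :: "('n::finite, 'c::finite) rpn_problem \<Rightarrow> real \<Rightarrow> real^'n \<Rightarrow> real^'n^'n" where
  "B12 P t x = (let J = act_set P t x in block J (- J) (Bfull P t x))"

definition vbar :: "('n::finite, 'c::finite) rpn_problem \<Rightarrow> real \<Rightarrow> real^'n \<Rightarrow> real^'n" where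
  "vbar P t x = part (act_set P t x) (pg_dir P t x)"

definition vhat :: "('n::finite, 'c::finite) rpn_problem \<Rightarrow> real \<Rightarrow> real^'n \<Rightarrow> real^'n" where
  "vhat P t x = part (- act_set P t x) (pg_dir P t x)"

definition ell :: "('n::finite, 'c::finite) rpn_problem \<Rightarrow> real \<Rightarrow> real^'n \<Rightarrow> real^'n" where
  "ell P t x = (let J = act_set P t x in
     (1 / t) *\<^sub>R ((- block J J (mat 1) + t *\<^sub>R B11 P t x) *v vbar P t x) + B12 P t x *v vhat P t x)"

definition Pproj :: "('n::finite, 'c::finite) rpn_problem \<Rightarrow> real \<Rightarrow> real^'n \<Rightarrow> real^'n^'n" where
  "Pproj P t x = (let J = act_set P t x; Bbar = part J (nbas P x) in
     block J J (mat 1) - Bbar ** moore_penrose_inverse Bbar)"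

datatype tcg_status = Early1 | Early2 | Early3 | Neg | Lin | Sup

definition Gmod ::
  "('n::finite, 'c::finite) rpn_problem \<Rightarrow> rpn_params \<Rightarrow> real \<Rightarrow> real^'n \<Rightarrow> real^'n \<Rightarrow> real" where
  "Gmod P A t x u =
     fsm P x + grad P x \<bullet> u + 1/2 * (u \<bullet> (Bfull P t x *v u))
       + tau A / 2 * (norm (part (- act_set P t x) u))\<^sup>2 + hreg P (x + u)"

text \<open>At \<open>v(x)\<close> and at every \<open>d\<^sub>i\<close> the hat part is that of \<open>v(x)\<close>.\<close>

definition low_curv ::
  "('n::finite, 'c::finite) rpn_problem \<Rightarrow> rpn_params \<Rightarrow> real \<Rightarrow> real^'n \<Rightarrow> real^'n \<Rightarrow> bool" where
  "low_curv P A t x u \<longleftrightarrow>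
     u \<bullet> (Bfull P t x *v u) + tau A * (norm (vhat P t x))\<^sup>2 < gam A * (norm u)\<^sup>2"

definition comb :: "('n::finite, 'c::finite) rpn_problem \<Rightarrow> real \<Rightarrow> real^'n \<Rightarrow> real^'n \<Rightarrow> real^'n" where
  "comb P t x w = vbar P t x + w + vhat P t x"

text \<open>\<open>tcg_loop P A t x r0 w r p \<delta> w' st\<close>: entering an iteration with iterate \<open>w\<close>, residual \<open>r\<close>, conjugate
  direction \<open>p\<close> (the \<open>o\<^sub>i\<close> of the method) and scalar \<open>\<delta>\<close>, the loop returns \<open>w'\<close> with status \<open>st\<close>.\<close>

inductive tcg_loop ::
  "('n::finite, 'c::finite) rpn_problem \<Rightarrow> rpn_params \<Rightarrow> real \<Rightarrow> real^'n \<Rightarrow> real^'n \<Rightarrow>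
   real^'n \<Rightarrow> real^'n \<Rightarrow> real^'n \<Rightarrow> real \<Rightarrow> real^'n \<Rightarrow> tcg_status \<Rightarrow> bool"
  for P A t x r0 where
  neg: "\<lbrakk>q = Pproj P t x *v (B11 P t x *v p); p \<bullet> q \<le> vartheta A * \<delta>\<rbrakk>
    \<Longrightarrow> tcg_loop P A t x r0 w r p \<delta> w Neg"
| early3: "\<lbrakk>q = Pproj P t x *v (B11 P t x *v p); \<not> p \<bullet> q \<le> vartheta A * \<delta>;
     a = (r \<bullet> r) / (p \<bullet> q); w1 = w + a *\<^sub>R p;
     low_curv P A t x (comb P t x w1) \<or> Gmod P A t x (comb P t x w1) > Gmod P A t x 0\<rbrakk>
    \<Longrightarrow> tcg_loop P A t x r0 w r p \<delta> w Early3"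
| conv: "\<lbrakk>q = Pproj P t x *v (B11 P t x *v p); \<not> p \<bullet> q \<le> vartheta A * \<delta>;
     a = (r \<bullet> r) / (p \<bullet> q); w1 = w + a *\<^sub>R p; r1 = r + a *\<^sub>R q;
     \<not> (low_curv P A t x (comb P t x w1) \<or> Gmod P A t x (comb P t x w1) > Gmod P A t x 0);
     norm r1 \<le> norm r0 * min (norm r0 powr theta A) (kappa A)\<rbrakk>
    \<Longrightarrow> tcg_loop P A t x r0 w r p \<delta> w1 (if norm r0 powr theta A > kappa A then Lin else Sup)"
| iter: "\<lbrakk>q = Pproj P t x *v (B11 P t x *v p); \<not> p \<bullet> q \<le> vartheta A * \<delta>;
     a = (r \<bullet> r) / (p \<bullet> q); w1 = w + a *\<^sub>R p; r1 = r + a *\<^sub>R q;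
     \<not> (low_curv P A t x (comb P t x w1) \<or> Gmod P A t x (comb P t x w1) > Gmod P A t x 0);
     \<not> norm r1 \<le> norm r0 * min (norm r0 powr theta A) (kappa A);
     b = (r1 \<bullet> r1) / (r \<bullet> r); p1 = - r1 + b *\<^sub>R p; \<delta>1 = r1 \<bullet> r1 + b\<^sup>2 * \<delta>;
     tcg_loop P A t x r0 w1 r1 p1 \<delta>1 w' st\<rbrakk>
    \<Longrightarrow> tcg_loop P A t x r0 w r p \<delta> w' st"

inductive tcg ::
  "('n::finite, 'c::finite) rpn_problem \<Rightarrow> rpn_params \<Rightarrow> real \<Rightarrow> real^'n \<Rightarrow>
   real^'n \<Rightarrow> tcg_status \<Rightarrow> bool"
  for P A t x where
  early1: "Gmod P A t x (pg_dir P t x) > Gmod P A t x 0 \<Longrightarrow> tcg P A t x 0 Early1"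
| early2: "\<lbrakk>\<not> Gmod P A t x (pg_dir P t x) > Gmod P A t x 0; low_curv P A t x (pg_dir P t x)\<rbrakk>
    \<Longrightarrow> tcg P A t x 0 Early2"
| loop: "\<lbrakk>\<not> Gmod P A t x (pg_dir P t x) > Gmod P A t x 0; \<not> low_curv P A t x (pg_dir P t x);
     r0 = Pproj P t x *v ell P t x; tcg_loop P A t x r0 0 r0 (- r0) (r0 \<bullet> r0) w st\<rbrakk>
    \<Longrightarrow> tcg P A t x w st"

definition search_dir ::
  "('n::finite, 'c::finite) rpn_problem \<Rightarrow> rpn_params \<Rightarrow> real \<Rightarrow> real^'n \<Rightarrow>
   real^'n \<Rightarrow> tcg_status \<Rightarrow> bool" where
  "search_dir P A t x d st \<longleftrightarrow> (\<exists>w. tcg P A t x w st \<and> d = comb P t x w)"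

definition suff_descent ::
  "('n::finite, 'c::finite) rpn_problem \<Rightarrow> real \<Rightarrow> real^'n \<Rightarrow> real^'n \<Rightarrow> real \<Rightarrow> bool" where
  "suff_descent P \<rho>1 x d \<alpha> \<longleftrightarrow>
     Fobj P (retr P x (\<alpha> *\<^sub>R d)) \<le> Fobj P x - \<alpha> * \<rho>1 * (norm d)\<^sup>2"

definition backtrack ::
  "('n::finite, 'c::finite) rpn_problem \<Rightarrow> rpn_params \<Rightarrow> real \<Rightarrow> real^'n \<Rightarrow> real^'n \<Rightarrow> real \<Rightarrow> bool" where
  "backtrack P A \<rho>1 x d \<alpha> \<longleftrightarrow>
     (\<exists>m. \<alpha> = ainit A * rho2 A ^ m \<and> suff_descent P \<rho>1 x d \<alpha> \<and>
        (\<forall>i<m. \<not> suff_descent P \<rho>1 x d (ainit A * rho2 A ^ i)))"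

definition next_t ::
  "rpn_params \<Rightarrow> real \<Rightarrow> real^'n \<Rightarrow> real^'n \<Rightarrow> tcg_status \<Rightarrow> real" where
  "next_t A t v d st =
     (if (4 + 1 / t) * norm d < norm v \<or> st = Early1 then max (varpi2 A * t) (tmin A)
      else if st \<noteq> Sup then min (varpi1 A * t) (tmax A)
      else t)"

text \<open>\<open>xs\<close>, \<open>ts\<close> and \<open>ds\<close> hold the current values of the \<open>x\<^sub>i\<close>, \<open>t\<^sub>i\<close> and \<open>d(x\<^sub>i)\<close>; the entries not yet
  computed are irrelevant.\<close>

record 'n rpn_state =
  idx :: nat
  flag :: nat
  xs :: "nat \<Rightarrow> real^'n"
  ts :: "nat \<Rightarrow> real"
  ds :: "nat \<Rightarrow> real^'n"

text \<open>\<open>rpn_step P A \<rho>1 s lab s'\<close> is one pass through the loop. The label is \<open>Some \<alpha>\<close> if the pass runs a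
  backtracking line search, with accepted step size \<open>\<alpha>\<close>, and \<open>None\<close> otherwise. The index \<open>k - 1\<close> is
  used only with flag \<open>1\<close>, hence \<open>k \<ge> 1\<close> in every reachable state.\<close>

inductive rpn_step ::
  "('n::finite, 'c::finite) rpn_problem \<Rightarrow> rpn_params \<Rightarrow> real \<Rightarrow>
   'n rpn_state \<Rightarrow> real option \<Rightarrow> 'n rpn_state \<Rightarrow> bool"
  for P A \<rho>1 where
  linesearch: "\<lbrakk>k = idx s; x = xs s k; t = ts s k; search_dir P A t x d st;
     t1 = next_t A t (pg_dir P t x) d st;
     st \<noteq> Sup; flag s \<noteq> 1;
     backtrack P A \<rho>1 x d \<alpha>\<rbrakk>
    \<Longrightarrow> rpn_step P A \<rho>1 s (Some \<alpha>)
      \<lparr>idx = k + 1, flag = 0, xs = (xs s)(k + 1 := retr P x (\<alpha> *\<^sub>R d)),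
       ts = (ts s)(k + 1 := t1), ds = (ds s)(k := d)\<rparr>"
| full_first: "\<lbrakk>k = idx s; x = xs s k; t = ts s k; search_dir P A t x d st;
     t1 = next_t A t (pg_dir P t x) d st;
     st = Sup \<or> flag s = 1; flag s + 1 = 1\<rbrakk>
    \<Longrightarrow> rpn_step P A \<rho>1 s None
      \<lparr>idx = k + 1, flag = flag s + 1, xs = (xs s)(k + 1 := retr P x d),
       ts = (ts s)(k + 1 := t1), ds = (ds s)(k := d)\<rparr>"
| full_accept: "\<lbrakk>k = idx s; x = xs s k; t = ts s k; search_dir P A t x d st;
     t1 = next_t A t (pg_dir P t x) d st;
     st = Sup \<or> flag s = 1; flag s + 1 \<noteq> 1;
     y = retr P x d; xp = xs s (k - 1); vp = pg_dir P (ts s (k - 1)) xp;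
     \<not> Fobj P y > Fobj P xp - \<rho>1 * (norm vp)\<^sup>2\<rbrakk>
    \<Longrightarrow> rpn_step P A \<rho>1 s None
      \<lparr>idx = k + 1, flag = 0, xs = (xs s)(k + 1 := y),
       ts = (ts s)(k + 1 := t1), ds = (ds s)(k := d)\<rparr>"
| full_reject: "\<lbrakk>k = idx s; x = xs s k; t = ts s k; search_dir P A t x d st;
     t1 = next_t A t (pg_dir P t x) d st;
     st = Sup \<or> flag s = 1; flag s + 1 \<noteq> 1;
     y = retr P x d; xp = xs s (k - 1); vp = pg_dir P (ts s (k - 1)) xp; dp = ds s (k - 1);
     Fobj P y > Fobj P xp - \<rho>1 * (norm vp)\<^sup>2;
     backtrack P A \<rho>1 xp dp \<alpha>\<rbrakk>
    \<Longrightarrow> rpn_step P A \<rho>1 s (Some \<alpha>)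
      \<lparr>idx = k, flag = 0, xs = (xs s)(k + 1 := y, k := retr P xp (\<alpha> *\<^sub>R dp)),
       ts = (ts s)(k + 1 := t1), ds = (ds s)(k := d)\<rparr>"

inductive rpn_reachable ::
  "('n::finite, 'c::finite) rpn_problem \<Rightarrow> rpn_params \<Rightarrow> real \<Rightarrow> real^'n \<Rightarrow> real \<Rightarrow>
   'n rpn_state \<Rightarrow> bool"
  for P A \<rho>1 x0 t0 where
  init: "\<lbrakk>idx s = 0; flag s = 0; xs s 0 = x0; ts s 0 = t0\<rbrakk> \<Longrightarrow> rpn_reachable P A \<rho>1 x0 t0 s"
| step: "\<lbrakk>rpn_reachable P A \<rho>1 x0 t0 s; rpn_step P A \<rho>1 s lab s'\<rbrakk>
    \<Longrightarrow> rpn_reachable P A \<rho>1 x0 t0 s'"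

end

theory Submission
  imports Defs
begin

text \<open>Every direction \<open>d\<close> produced by truncated CG is tangent and satisfies
  \<open>\<langle>\<nabla>f(x), d\<rangle> + h(x + d) - h(x) \<le> - c \<parallel>d\<parallel>\<^sup>2\<close> with \<open>c = min (\<gamma> / 2) (1 / (2 t\<^sub>m\<^sub>a\<^sub>x))\<close>: either \<open>d = v(x)\<close>,
  and the bound comes from comparing the proximal step with the zero step, or \<open>d\<close> has passed the
  curvature and model decrease tests, and the bound is their combination. By compactness of \<open>M\<close>,
  \<open>\<parallel>R\<^sub>x(u) - x - u\<parallel> \<le> C \<parallel>u\<parallel>\<^sup>2\<close> uniformly on the whole tangent bundle, so the Lipschitz gradient of \<open>f\<close>
  and the convexity and Lipschitz continuity of \<open>h\<close> give
  \<open>F(R\<^sub>x(\<alpha> d)) \<le> F(x) - \<alpha> c \<parallel>d\<parallel>\<^sup>2 + K \<alpha>\<^sup>2 \<parallel>d\<parallel>\<^sup>2\<close>. The Hessian and the Weingarten map enter only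
  through the tests.\<close>

subsection \<open>Smooth maps and tangent spaces\<close>

text \<open>Openness makes Frechet derivatives at points of \<open>S\<close> depend only on values
  in \<open>S\<close>, so the induction passes to derivatives. This serves to replace a derivative
  by a formula that is valid only on \<open>S\<close>.\<close>

lemma Ck_on_cong:
  assumes "open S" and "\<And>x. x \<in> S \<Longrightarrow> f x = g x" and "Ck_on k S f"
  shows "Ck_on k S g"
  using assms
proof (induction k arbitrary: f g)
  case 0
  then show ?case using continuous_on_eq by fastforce
next
  case (Suc k)
  have der: "(g has_derivative frechet_derivative f (at x)) (at x)" if "x \<in> S" for x
  proof (rule has_derivative_transform_within_open[OF _ \<open>open S\<close> that Suc.prems(2)])
    show "(f has_derivative frechet_derivative f (at x)) (at x)"
      using Suc.prems(3) that by (simp add: frechet_derivative_works)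
  qed
  have eq: "frechet_derivative f (at x) v = frechet_derivative g (at x) v" if "x \<in> S" for x v
    using frechet_derivative_at[OF der[OF that]] by simp
  have "Ck_on k S (\<lambda>x. frechet_derivative g (at x) v)" for v
    by (rule Suc.IH[OF \<open>open S\<close> eq]) (use Suc.prems(3) in auto)
  then show ?case
    using der by (auto simp: differentiable_def)
qed

text \<open>The derivative of the composite in direction \<open>r\<close> is the derivative of
  \<open>g\<close> in the fixed direction \<open>A r\<close>, composed with the same affine map, so
  the induction closes without a product rule. It is applied to straight lines followed by an
  inverse chart.\<close>

lemma Ck_on_compose_affine:
  assumes "open S" and A: "bounded_linear A" and "(\<lambda>s. a + A s) ` S \<subseteq> V" and "Ck_on k V g"
  shows "Ck_on k S (\<lambda>s. g (a + A s))"
  using assms(4)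
proof (induction k arbitrary: g)
  case 0
  interpret bounded_linear A by fact
  have "continuous_on S (\<lambda>s. a + A s)"
    by (intro continuous_intros linear_continuous_on A)
  with 0 assms(3) show ?case
    by (auto intro: continuous_on_compose2)
next
  case (Suc k)
  interpret bounded_linear A by fact
  have der: "((\<lambda>s. g (a + A s)) has_derivative
      (\<lambda>r. frechet_derivative g (at (a + A s)) (A r))) (at s)" if "s \<in> S" for s
  proof -
    have "(g has_derivative frechet_derivative g (at (a + A s))) (at (a + A s))"
      using Suc.prems assms(3) that by (auto simp: frechet_derivative_works)
    moreover have "((\<lambda>s. a + A s) has_derivative A) (at s)"
      using has_derivative_add[OF has_derivative_const bounded_linear_imp_has_derivative[OF A]] by simp
    ultimately show ?thesis
      by (rule has_derivative_compose[rotated])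
  qed
  have "Ck_on k S (\<lambda>s. frechet_derivative (\<lambda>s. g (a + A s)) (at s) r)" for r
  proof (rule Ck_on_cong[OF \<open>open S\<close>])
    show "Ck_on k S (\<lambda>s. frechet_derivative g (at (a + A s)) (A r))"
      using Suc by auto
    show "frechet_derivative g (at (a + A s)) (A r) = frechet_derivative (\<lambda>s. g (a + A s)) (at s) r"
      if "s \<in> S" for s
      using frechet_derivative_at[OF der[OF that]] by metis
  qed
  with der show ?case
    by (auto simp: differentiable_def)
qed

lemma smooth_on_has_derivative:
  assumes "smooth_on S g" and "x \<in> S"
  shows "(g has_derivative frechet_derivative g (at x)) (at x)"
proof -
  have "Ck_on (Suc 0) S g"
    using assms by (auto simp: smooth_on_def)
  with assms show ?thesis
    by (simp add: frechet_derivative_works)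
qed

text \<open>In a slice chart with inverse \<open>\<psi>\<close> and slice \<open>L\<close>, the tangent space is the image of \<open>L\<close> under the
  derivative of \<open>\<psi>\<close>.\<close>

lemma subspace_tangent_space:
  fixes M :: "'a::euclidean_space set"
  assumes "embedded_submanifold m M" and "x \<in> M"
  shows "subspace (tangent_space M x)"
proof -
  from assms obtain U V :: "'a set" and \<phi> \<psi> L where U: "open U" "x \<in> U" and V: "open V"
    and hom: "homeomorphism U V \<phi> \<psi>" and smooth: "smooth_on U \<phi>" "smooth_on V \<psi>"
    and L: "subspace L" and slice: "\<phi> ` (U \<inter> M) = V \<inter> L"
    unfolding embedded_submanifold_def by (elim ballE[of _ _ x] exE conjE) auto
  define p where "p = \<phi> x"
  define A where "A = frechet_derivative \<phi> (at x)"
  define B where "B = frechet_derivative \<psi> (at p)"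
  have p: "p \<in> V" "p \<in> L"
    using slice U assms by (auto simp: p_def)
  have A: "(\<phi> has_derivative A) (at x)"
    unfolding A_def using smooth U by (intro smooth_on_has_derivative)
  have B: "(\<psi> has_derivative B) (at p)"
    unfolding B_def using smooth p by (intro smooth_on_has_derivative)
  have psi_phi: "\<psi> (\<phi> y) = y" if "y \<in> U" for y
    using hom that by (rule homeomorphism_apply1)
  \<comment> \<open>Chain rule for \<psi> after \<phi>, which is the identity near \<open>x\<close>.
    A tangent vector \<open>v\<close> is thus the image under \<open>B\<close> of
    \<open>A v\<close>, and it remains to see that \<open>A v\<close> lies in
    \<open>L\<close>.\<close>
  have BA: "B (A v) = v" for v
  proof -
    have "((\<lambda>y. \<psi> (\<phi> y)) has_derivative (\<lambda>v. B (A v))) (at x)"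
      using A B has_derivative_compose unfolding p_def by blast
    then have "((\<lambda>y. y) has_derivative (\<lambda>v. B (A v))) (at x)"
      using psi_phi U by (auto intro: has_derivative_transform_within_open)
    then have "(\<lambda>v. B (A v)) = (\<lambda>v. v)"
      using has_derivative_ident by (rule has_derivative_unique)
    then show ?thesis by metis
  qed
  have "tangent_space M x = B ` L"
  proof (intro equalityI subsetI)
    fix v assume "v \<in> tangent_space M x"
    then obtain \<epsilon> \<gamma> where "\<epsilon> > 0" and gM: "\<gamma> ` {-\<epsilon><..<\<epsilon>} \<subseteq> M" and g0: "\<gamma> 0 = x"
      and gd: "(\<gamma> has_vector_derivative v) (at 0)"
      unfolding tangent_space_def by blast
    have "isCont \<gamma> 0"
      using gd by (rule has_vector_derivative_continuous)
    then have "\<forall>\<^sub>F s in nhds 0. \<gamma> s \<in> U"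
      using topological_tendstoD[of \<gamma> "\<gamma> 0" "at 0" U] U g0
      by (auto simp: isCont_def eventually_nhds_conv_at)
    moreover have "\<forall>\<^sub>F s in nhds 0. s \<in> {-\<epsilon><..<\<epsilon>}"
      using \<open>\<epsilon> > 0\<close> by (intro eventually_nhds_in_open) auto
    ultimately have "\<forall>\<^sub>F s in nhds 0. \<phi> (\<gamma> s) \<in> L"
    proof eventually_elim
      case (elim s)
      then have "\<gamma> s \<in> U \<inter> M"
        using gM by auto
      then show ?case
        using slice by blast
    qed
    then obtain S where S: "open S" "0 \<in> S" "\<And>s. s \<in> S \<Longrightarrow> \<phi> (\<gamma> s) \<in> L"
      by (auto simp: eventually_nhds)
    have pg: "((\<lambda>s. \<phi> (\<gamma> s)) has_derivative (\<lambda>r. A (r *\<^sub>R v))) (at 0)"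
      using has_derivative_compose[of \<gamma> "\<lambda>r. r *\<^sub>R v" 0 UNIV \<phi> A] A gd g0
      by (simp add: has_vector_derivative_def)
    \<comment> \<open>The charted curve stays in \<open>L\<close> near 0, so its inner product with
      any normal \<open>z\<close> of \<open>L\<close> is constantly zero there and has derivative
      zero. Hence its velocity lies in the double orthogonal complement of \<open>L\<close>.\<close>
    have "A v \<bullet> z = 0" if z: "\<And>l. l \<in> L \<Longrightarrow> l \<bullet> z = 0" for z
    proof -
      have "((\<lambda>s. \<phi> (\<gamma> s) \<bullet> z) has_derivative (\<lambda>r. A (r *\<^sub>R v) \<bullet> z)) (at 0)"
        using pg by (rule has_derivative_inner_left)
      moreover have "((\<lambda>s. \<phi> (\<gamma> s) \<bullet> z) has_derivative (\<lambda>r. 0)) (at 0)"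
        by (rule has_derivative_transform_within_open[of "\<lambda>_. 0" _ _ _ S]) (use S z in auto)
      ultimately have "(\<lambda>r. A (r *\<^sub>R v) \<bullet> z) = (\<lambda>r. 0)"
        by (rule has_derivative_unique)
      then show ?thesis
        by (metis scaleR_one)
    qed
    then have "A v \<in> orthogonal_comp (orthogonal_comp L)"
      by (auto simp: orthogonal_comp_def orthogonal_def inner_commute)
    then have "A v \<in> L"
      using orthogonal_comp_self[OF L] by simp
    then show "v \<in> B ` L"
      using BA by (metis imageI)
  next
    fix v assume "v \<in> B ` L"
    then obtain l where l: "l \<in> L" "v = B l" by auto
    obtain e where e: "e > 0" "ball p e \<subseteq> V"
      using V p by (meson openE)
    \<comment> \<open>The summand 1 keeps the quotient defined for \<open>l = 0\<close>.\<close>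
    define \<epsilon> where "\<epsilon> = e / (norm l + 1)"
    define \<gamma> where "\<gamma> = (\<lambda>s. \<psi> (p + s *\<^sub>R l))"
    have "\<epsilon> > 0"
      using e by (simp add: \<epsilon>_def add_nonneg_pos)
    have inV: "p + s *\<^sub>R l \<in> V" if "s \<in> {-\<epsilon><..<\<epsilon>}" for s
    proof -
      have "\<bar>s\<bar> * norm l \<le> \<bar>s\<bar> * (norm l + 1)"
        by (intro mult_left_mono) auto
      also have "\<dots> < e"
      proof -
        have "\<bar>s\<bar> < \<epsilon>"
          using that by auto
        then show ?thesis
          by (simp add: \<epsilon>_def pos_less_divide_eq add_nonneg_pos)
      qed
      finally show ?thesis
        using e by (auto simp: dist_norm)
    qed
    have "smooth_on {-\<epsilon><..<\<epsilon>} \<gamma>"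
      unfolding smooth_on_def \<gamma>_def
      using smooth inV
      by (auto intro!: Ck_on_compose_affine[where V = V] bounded_linear_scaleR_left simp: smooth_on_def)
    moreover have "\<gamma> s \<in> M" if "s \<in> {-\<epsilon><..<\<epsilon>}" for s
    proof -
      have "p + s *\<^sub>R l \<in> V \<inter> L"
        using inV[OF that] p l L by (simp add: subspace_add subspace_scale)
      then show ?thesis
        using slice psi_phi unfolding \<gamma>_def by (metis IntD1 IntD2 imageE)
    qed
    moreover have "\<gamma> 0 = x"
      using psi_phi U by (simp add: \<gamma>_def p_def)
    moreover have "(\<gamma> has_vector_derivative v) (at 0)"
    proof -
      have "((\<lambda>s. p + s *\<^sub>R l) has_derivative (\<lambda>r. r *\<^sub>R l)) (at 0)"
        by (auto intro!: derivative_eq_intros)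
      then have "(\<gamma> has_derivative (\<lambda>r. B (r *\<^sub>R l))) (at 0)"
        unfolding \<gamma>_def using has_derivative_compose[where g = \<psi> and g' = B] B by fastforce
      moreover have "B (r *\<^sub>R l) = r *\<^sub>R v" for r
        using B l by (simp add: has_derivative_linear linear_cmul)
      ultimately show ?thesis
        by (simp add: has_vector_derivative_def)
    qed
    ultimately show "v \<in> tangent_space M x"
      unfolding tangent_space_def using \<open>\<epsilon> > 0\<close> by blast
  qed
  moreover have "linear B"
    using B by (rule has_derivative_linear)
  ultimately show ?thesis
    using L by (simp add: linear_subspace_image)
qed

subsection \<open>Second-order accuracy of retractions\<close>

text \<open>A second-order Taylor estimate obtained by applying the mean value inequality twice,
  first to the directional derivatives and then to \<open>g\<close>. The constant is uniform in the
  base point \<open>z\<close>, as required when the foot point of a retraction varies.\<close>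

lemma C2_linearization_bound:
  fixes g :: "'a::euclidean_space \<Rightarrow> 'b::real_normed_vector"
  assumes "open U" and "p \<in> U" and C2: "Ck_on (Suc (Suc 0)) U g"
  obtains \<delta> C where "\<delta> > 0" "C \<ge> 0" "ball p \<delta> \<subseteq> U"
    "\<And>z w. z \<in> ball p \<delta> \<Longrightarrow> z + w \<in> ball p \<delta> \<Longrightarrow>
       norm (g (z + w) - g z - frechet_derivative g (at z) w) \<le> C * (norm w)\<^sup>2"
proof -
  define D where "D b x = frechet_derivative g (at x) b" for b x
  define H where "H b c x = frechet_derivative (D b) (at x) c" for b c x
  obtain \<delta> where d: "\<delta> > 0" "cball p \<delta> \<subseteq> U"
    using assms by (meson open_contains_cball)
  have "continuous_on U (H b c)" for b c
    using C2 unfolding H_def D_def by simp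
  then have "compact (H b c ` cball p \<delta>)" for b c
    using d by (intro compact_continuous_image compact_cball) (rule continuous_on_subset)
  then have "\<exists>K. \<forall>x\<in>cball p \<delta>. norm (H b c x) \<le> K" for b c
    using compact_imp_bounded[of "H b c ` cball p \<delta>" for b c] unfolding bounded_iff
    by (metis imageI)
  then obtain K where K: "\<And>b c x. x \<in> cball p \<delta> \<Longrightarrow> norm (H b c x) \<le> K b c"
    by metis
  have Knn: "0 \<le> K b c" for b c
    using K[of p b c] d order_trans[OF norm_ge_zero] by force
  \<comment> \<open>\<open>K b c\<close> bounds one second directional derivative on the compact
    ball. Continuity is known only direction by direction, so operator norms are estimated by sums
    over basis vectors, as in \<open>expand\<close> below.\<close>
  define C where "C = (\<Sum>b\<in>Basis. \<Sum>c\<in>Basis. K b c)"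
  have Cnn: "C \<ge> 0"
    unfolding C_def by (intro sum_nonneg Knn)
  have gd: "(g has_derivative (\<lambda>b. D b x)) (at x)" if "x \<in> U" for x
    using C2 that by (simp add: D_def frechet_derivative_works)
  have Dd: "(D b has_derivative (\<lambda>c. H b c x)) (at x)" if "x \<in> U" for b x
  proof -
    have "D b differentiable at x"
      using C2 that by (auto simp: D_def[abs_def])
    then show ?thesis
      by (simp add: H_def frechet_derivative_works)
  qed
  have expand: "norm (l v) \<le> (\<Sum>b\<in>Basis. norm (l b)) * norm v" if "linear l" for l :: "'a \<Rightarrow> 'b" and v
  proof -
    have "l v = (\<Sum>b\<in>Basis. (v \<bullet> b) *\<^sub>R l b)"
      using that by (metis (no_types, lifting) euclidean_representation linear_cmul linear_sum sum.cong)
    also have "norm \<dots> \<le> (\<Sum>b\<in>Basis. \<bar>v \<bullet> b\<bar> * norm (l b))"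
      by (rule order_trans[OF norm_sum]) simp
    also have "\<dots> \<le> (\<Sum>b\<in>Basis. norm v * norm (l b))"
      by (intro sum_mono mult_right_mono Basis_le_norm) auto
    finally show ?thesis
      by (simp add: sum_distrib_left mult.commute)
  qed
  have lip: "norm (D b y - D b z) \<le> (\<Sum>c\<in>Basis. K b c) * norm (y - z)"
    if "y \<in> ball p \<delta>" "z \<in> ball p \<delta>" for b y z
  proof (rule differentiable_bound[where S = "ball p \<delta>"])
    fix x assume x: "x \<in> ball p \<delta>"
    then have xU: "x \<in> U" using d by auto
    show "(D b has_derivative (\<lambda>c. H b c x)) (at x within ball p \<delta>)"
      using Dd[OF xU] by (rule has_derivative_at_withinI)
    have "linear (\<lambda>c. H b c x)"
      using Dd[OF xU] by (rule has_derivative_linear)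
    then have "norm (H b c x) \<le> (\<Sum>c\<in>Basis. norm (H b c x)) * norm c" for c
      by (rule expand)
    also have "(\<Sum>c\<in>Basis. norm (H b c x)) * norm c \<le> (\<Sum>c\<in>Basis. K b c) * norm c" for c
      using x by (intro mult_right_mono sum_mono K) auto
    finally show "onorm (\<lambda>c. H b c x) \<le> (\<Sum>c\<in>Basis. K b c)"
      by (intro onorm_bound sum_nonneg Knn)
  qed (use that in auto)
  have "norm (g (z + w) - g z - D w z) \<le> C * (norm w)\<^sup>2"
    if z: "z \<in> ball p \<delta>" and zw: "z + w \<in> ball p \<delta>" for z w
  proof -
    let ?S = "closed_segment z (z + w)"
    have S: "?S \<subseteq> ball p \<delta>"
      using z zw by (intro closed_segment_subset) auto
    have "norm (g (z + w) - g z - (\<lambda>x b. D b x) z (z + w - z)) \<le> norm (z + w - z) * (C * norm w)"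
    proof (rule differentiable_bound_linearization[where S = ?S])
      show "z + t *\<^sub>R (z + w - z) \<in> ?S" if "t \<in> {0..1}" for t :: real
        using that by (auto simp: closed_segment_def algebra_simps intro!: exI[of _ t])
      fix x assume x: "x \<in> ?S"
      then have xU: "x \<in> U" using S d ball_subset_cball by blast
      show "(g has_derivative (\<lambda>b. D b x)) (at x within ?S)"
        using gd[OF xU] by (rule has_derivative_at_withinI)
      have zU: "z \<in> U" using z d by auto
      have "linear (\<lambda>b. D b x - D b z)"
        using gd[OF xU] gd[OF zU] by (intro linear_compose_sub has_derivative_linear)
      then have "norm (D b x - D b z) \<le> (\<Sum>b\<in>Basis. norm (D b x - D b z)) * norm b" for b
        by (rule expand)
      also have "(\<Sum>b\<in>Basis. norm (D b x - D b z)) * norm b \<le> (C * norm w) * norm b" for b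
      proof (rule mult_right_mono)
        have "norm (x - z) \<le> norm w"
          using x segment_bound1[of x z "z + w"] by simp
        then have "norm (D b x - D b z) \<le> (\<Sum>c\<in>Basis. K b c) * norm w" for b
          using S x z Knn
          by (intro order_trans[OF lip] mult_left_mono sum_nonneg) auto
        then show "(\<Sum>b\<in>Basis. norm (D b x - D b z)) \<le> C * norm w"
          unfolding C_def sum_distrib_right by (intro sum_mono)
            (simp add: sum_distrib_right)
      qed simp
      finally show "onorm ((\<lambda>x b. D b x) x - (\<lambda>x b. D b x) z) \<le> C * norm w"
        using Cnn by (intro onorm_bound) auto
    qed auto
    then show ?thesis
      by (simp add: power2_eq_square mult.commute mult.left_commute)
  qed
  then show thesis
    using that[OF d(1) Cnn] d(2) ball_subset_cball unfolding D_def by blast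
qed

text \<open>A smooth extension \<open>e\<close> of the retraction to a neighbourhood of
  \<open>(x, 0)\<close> obeys the Taylor estimate at every base point \<open>(y, 0)\<close> nearby,
  so one constant serves all nearby \<open>y\<close>. The linear term is \<open>u\<close> because
  the retraction has identity derivative at the zero vector.\<close>

lemma retraction_local_bound:
  assumes R: "manifold_retraction M R" and T: "\<And>x. x \<in> M \<Longrightarrow> subspace (tangent_space M x)"
    and "x \<in> M"
  obtains \<delta> C where "\<delta> > 0" "C \<ge> 0"
    "\<And>y u. y \<in> M \<Longrightarrow> dist x y < \<delta> \<Longrightarrow> u \<in> tangent_space M y \<Longrightarrow> norm u < \<delta> \<Longrightarrow>
       norm (R y u - y - u) \<le> C * (norm u)\<^sup>2"
proof -
  have "(x, 0) \<in> tangent_bundle M"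
    using T[OF \<open>x \<in> M\<close>] \<open>x \<in> M\<close> by (simp add: tangent_bundle_def subspace_0)
  then obtain U e where U: "open U" "(x, 0) \<in> U" and e: "smooth_on U e"
    and eR: "\<And>y u. (y, u) \<in> U \<Longrightarrow> y \<in> M \<Longrightarrow> u \<in> tangent_space M y \<Longrightarrow> e (y, u) = R y u"
    using R unfolding manifold_retraction_def smooth_map_on_def tangent_bundle_def by fastforce
  obtain \<delta> C where d: "\<delta> > 0" "C \<ge> 0" "ball (x, 0) \<delta> \<subseteq> U"
    and bd: "\<And>z w. z \<in> ball (x, 0) \<delta> \<Longrightarrow> z + w \<in> ball (x, 0) \<delta> \<Longrightarrow>
       norm (e (z + w) - e z - frechet_derivative e (at z) w) \<le> C * (norm w)\<^sup>2"
    using C2_linearization_bound[of U "(x, 0)" e] U e unfolding smooth_on_def by metis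
  have "norm (R y u - y - u) \<le> C * (norm u)\<^sup>2"
    \<comment> \<open>Half the radius for each component keeps the pair within distance \<delta> of
      \<open>(x, 0)\<close>.\<close>
    if y: "y \<in> M" "dist x y < \<delta> / 2" and u: "u \<in> tangent_space M y" "norm u < \<delta> / 2" for y u
  proof -
    have in_ball: "(y, s *\<^sub>R u) \<in> ball (x, 0) \<delta>" if "s \<in> {0..1}" for s :: real
    proof -
      have "dist (x, 0) (y, s *\<^sub>R u) \<le> dist x y + \<bar>s\<bar> * norm u"
        unfolding dist_Pair_Pair by (rule order_trans[OF sqrt_sum_squares_le_sum]) auto
      also have "\<bar>s\<bar> * norm u \<le> norm u"
        using that by (simp add: mult_left_le_one_le)
      finally show ?thesis
        using y u by simp
    qed
    have su: "s *\<^sub>R u \<in> tangent_space M y" for s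
      using u T[OF y(1)] by (simp add: subspace_scale)
    have eR': "e (y, s *\<^sub>R u) = R y (s *\<^sub>R u)" if "s \<in> {0..1}" for s
      using in_ball[OF that] d y su by (intro eR) auto
    have R0: "R y 0 = y" and Rd: "(R y has_derivative (\<lambda>u. u)) (at 0 within tangent_space M y)"
      using R y unfolding manifold_retraction_def by auto
    \<comment> \<open>\<open>e\<close> agrees with the retraction only on the tangent bundle, so
      \<open>D (0, u) = u\<close> is read off along the segment of vectors
      \<open>s *\<^sub>R u\<close>, which stays in it. Differentiating both expressions at the
      endpoint 0 and using uniqueness there gives the identity.\<close>
    define D where "D = frechet_derivative e (at (y, 0))"
    have D: "(e has_derivative D) (at (y, 0))"
      unfolding D_def using e in_ball[of 0] d by (intro smooth_on_has_derivative) auto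
    have "((\<lambda>s. e (y, s *\<^sub>R u)) has_vector_derivative D (0, u)) (at 0 within cbox 0 1)"
    proof -
      have "((\<lambda>s. (y, s *\<^sub>R u)) has_derivative (\<lambda>r. (0, r *\<^sub>R u))) (at 0 within cbox 0 1)"
        by (auto intro!: derivative_eq_intros)
      then have "((\<lambda>s. e (y, s *\<^sub>R u)) has_derivative (\<lambda>r. D (0, r *\<^sub>R u))) (at 0 within cbox 0 1)"
        using has_derivative_compose[where g = e and g' = D] D by fastforce
      moreover have "D (0, r *\<^sub>R u) = r *\<^sub>R D (0, u)" for r
        using linear_cmul[OF has_derivative_linear[OF D], of r "(0, u)"] by simp
      ultimately show ?thesis
        by (simp add: has_vector_derivative_def)
    qed
    moreover have "((\<lambda>s. e (y, s *\<^sub>R u)) has_vector_derivative u) (at 0 within cbox 0 1)"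
    proof -
      have "((\<lambda>s. s *\<^sub>R u) has_derivative (\<lambda>r. r *\<^sub>R u)) (at 0 within cbox 0 1)"
        by (auto intro!: derivative_eq_intros)
      moreover have "(R y has_derivative (\<lambda>u. u)) (at (0 *\<^sub>R u) within (\<lambda>s. s *\<^sub>R u) ` cbox 0 1)"
        using Rd su by (auto intro: has_derivative_subset)
      ultimately have "((\<lambda>s. R y (s *\<^sub>R u)) has_derivative (\<lambda>r. r *\<^sub>R u)) (at 0 within cbox 0 1)"
        by (rule has_derivative_in_compose)
      then have "((\<lambda>s. e (y, s *\<^sub>R u)) has_derivative (\<lambda>r. r *\<^sub>R u)) (at 0 within cbox 0 1)"
        by (rule has_derivative_transform[rotated 2]) (auto simp: eR')
      then show ?thesis
        by (simp add: has_vector_derivative_def)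
    qed
    ultimately have "D (0, u) = u"
      by (intro vector_derivative_unique_within_closed_interval[of 0 1 0]) auto
    moreover have "e (y, 0) = y" "e (y, u) = R y u"
      using eR'[of 0] eR'[of 1] R0 by auto
    ultimately show ?thesis
      using bd[of "(y, 0)" "(0, u)"] in_ball[of 0] in_ball[of 1] by (simp add: D_def)
  qed
  then show thesis
    using that[of "\<delta> / 2" C] d by auto
qed

text \<open>Away from the zero section both bounds hold trivially, because \<open>R\<close> takes values in the bounded
  set \<open>M\<close>.\<close>

lemma retraction_bounds:
  assumes R: "manifold_retraction M R" and "compact M"
    and T: "\<And>x. x \<in> M \<Longrightarrow> subspace (tangent_space M x)"
  obtains C where "C \<ge> 0"
    "\<And>y u. y \<in> M \<Longrightarrow> u \<in> tangent_space M y \<Longrightarrow> norm (R y u - y - u) \<le> C * (norm u)\<^sup>2"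
    "\<And>y u. y \<in> M \<Longrightarrow> u \<in> tangent_space M y \<Longrightarrow> norm (R y u - y) \<le> C * norm u"
proof -
  have "\<exists>\<delta> C. \<delta> > 0 \<and> C \<ge> 0 \<and> (\<forall>y u. y \<in> M \<longrightarrow> dist x y < \<delta> \<longrightarrow> u \<in> tangent_space M y \<longrightarrow>
      norm u < \<delta> \<longrightarrow> norm (R y u - y - u) \<le> C * (norm u)\<^sup>2)" if "x \<in> M" for x
    using retraction_local_bound[OF R T that] by metis
  then obtain \<delta> C where dC: "\<And>x. x \<in> M \<Longrightarrow> \<delta> x > 0" "\<And>x. x \<in> M \<Longrightarrow> C x \<ge> 0"
    and loc: "\<And>x y u. x \<in> M \<Longrightarrow> y \<in> M \<Longrightarrow> dist x y < \<delta> x \<Longrightarrow> u \<in> tangent_space M y \<Longrightarrow>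
      norm u < \<delta> x \<Longrightarrow> norm (R y u - y - u) \<le> C x * (norm u)\<^sup>2"
    by metis
  obtain N where N: "N \<subseteq> M" "finite N" "M \<subseteq> (\<Union>x\<in>N. ball x (\<delta> x))"
  proof (rule compactE_image[OF \<open>compact M\<close>, of M "\<lambda>x. ball x (\<delta> x)"])
    show "M \<subseteq> (\<Union>x\<in>M. ball x (\<delta> x))"
      using dC(1) by force
  qed (use open_ball in auto)
  \<comment> \<open>Inserting 1 keeps the minimum meaningful for an empty cover.\<close>
  define \<epsilon> where "\<epsilon> = Min (insert 1 (\<delta> ` N))"
  define C1 where "C1 = (\<Sum>x\<in>N. C x)"
  have eps: "\<epsilon> > 0" "\<And>x. x \<in> N \<Longrightarrow> \<epsilon> \<le> \<delta> x"
    unfolding \<epsilon>_def using N dC by (auto simp: subset_iff)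
  have CN: "C x \<ge> 0" if "x \<in> N" for x
    using that N dC by auto
  have C1: "C1 \<ge> 0" "\<And>x. x \<in> N \<Longrightarrow> C x \<le> C1"
    unfolding C1_def using CN N by (auto intro: sum_nonneg member_le_sum)
  obtain Q where Q: "Q > 0" "\<And>y. y \<in> M \<Longrightarrow> norm y \<le> Q"
    using compact_imp_bounded[OF \<open>compact M\<close>] unfolding bounded_pos by blast
  \<comment> \<open>In \<open>C2\<close> and \<open>C3\<close> the first entry covers
    \<open>norm u < \<epsilon>\<close>. The second covers the opposite case, where a displacement of
    at most \<open>2 * Q\<close> is absorbed by powers of \<open>norm u / \<epsilon>\<close>, which
    is at least 1.\<close>
  define C2 where "C2 = max C1 (2 * Q / \<epsilon>\<^sup>2 + 1 / \<epsilon>)"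
  define C3 where "C3 = max (1 + C1 * \<epsilon>) (2 * Q / \<epsilon>)"
  have two: "norm (R y u - y - u) \<le> C2 * (norm u)\<^sup>2 \<and> norm (R y u - y) \<le> C3 * norm u"
    if y: "y \<in> M" and u: "u \<in> tangent_space M y" for y u
  proof (cases "norm u < \<epsilon>")
    case True
    obtain x where x: "x \<in> N" "dist x y < \<delta> x"
      using N y by auto
    then have "norm (R y u - y - u) \<le> C x * (norm u)\<^sup>2"
      using True y u N eps(2)[of x] by (intro loc) auto
    also have "\<dots> \<le> C1 * (norm u)\<^sup>2"
      using C1 x by (intro mult_right_mono) auto
    finally have a: "norm (R y u - y - u) \<le> C1 * (norm u)\<^sup>2" .
    also have "\<dots> \<le> C2 * (norm u)\<^sup>2"
      by (intro mult_right_mono) (auto simp: C2_def)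
    finally have b: "norm (R y u - y - u) \<le> C2 * (norm u)\<^sup>2" .
    have "norm (R y u - y) \<le> norm (R y u - y - u) + norm u"
      by (metis diff_add_cancel norm_triangle_ineq)
    also have "\<dots> \<le> C1 * (norm u)\<^sup>2 + norm u"
      using a by simp
    also have "C1 * (norm u)\<^sup>2 \<le> C1 * \<epsilon> * norm u"
      using True C1 by (simp add: power2_eq_square mult_left_mono mult_right_mono mult.assoc)
    finally have "norm (R y u - y) \<le> (1 + C1 * \<epsilon>) * norm u"
      by (simp add: algebra_simps)
    also have "\<dots> \<le> C3 * norm u"
      by (intro mult_right_mono) (auto simp: C3_def)
    finally show ?thesis
      using b by simp
  next
    case False
    have "R y u \<in> M"
      using R y u by (auto simp: manifold_retraction_def)
    then have a: "norm (R y u - y) \<le> 2 * Q"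
      using Q(2)[of y] Q(2)[of "R y u"] y norm_triangle_ineq4[of "R y u" y] by linarith
    also have "\<dots> \<le> 2 * Q / \<epsilon> * norm u"
      using False eps Q by (simp add: pos_le_divide_eq mult_left_mono)
    also have "\<dots> \<le> C3 * norm u"
      by (intro mult_right_mono) (auto simp: C3_def)
    finally have c: "norm (R y u - y) \<le> C3 * norm u" .
    have sq: "\<epsilon>\<^sup>2 \<le> (norm u)\<^sup>2"
      using False eps by (intro power_mono) auto
    have pr: "\<epsilon> * norm u \<le> (norm u)\<^sup>2"
      using False unfolding power2_eq_square by (intro mult_right_mono) auto
    have "norm (R y u - y - u) \<le> 2 * Q + norm u"
      using a norm_triangle_ineq4[of "R y u - y" u] by linarith
    also have "\<dots> \<le> 2 * Q / \<epsilon>\<^sup>2 * (norm u)\<^sup>2 + 1 / \<epsilon> * (norm u)\<^sup>2"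
      using sq pr eps Q
      by (intro add_mono) (auto simp: pos_le_divide_eq mult_left_mono mult.commute)
    also have "\<dots> \<le> C2 * (norm u)\<^sup>2"
      by (subst distrib_right[symmetric], intro mult_right_mono) (auto simp: C2_def)
    finally show ?thesis
      using c by simp
  qed
  define C' where "C' = max C2 C3"
  have "C' \<ge> 0"
    using C1 by (simp add: C'_def C2_def le_max_iff_disj)
  moreover have "norm (R y u - y - u) \<le> C' * (norm u)\<^sup>2" "norm (R y u - y) \<le> C' * norm u"
    if "y \<in> M" "u \<in> tangent_space M y" for y u
    using two[OF that] mult_right_mono[of C2 C' "(norm u)\<^sup>2"] mult_right_mono[of C3 C' "norm u"]
    by (auto simp: C'_def)
  ultimately show thesis
    using that by blast
qed

subsection \<open>Moore--Penrose inverses\<close>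

text \<open>For a single right-hand side \<open>b\<close>, split off the component orthogonal to the
  range of \<open>A\<close>: the transpose of \<open>A\<close> annihilates it, and the rest is
  \<open>A *v x\<close>. The unit vectors as right-hand sides yield the columns of
  \<open>Y\<close>.\<close>

lemma normal_equations_solvable:
  fixes A :: "real^'m^'n"
  shows "\<exists>Y. transpose A ** A ** Y = transpose A"
proof -
  have "\<exists>x. transpose A *v (A *v x) = transpose A *v b" for b
  proof -
    obtain y z where y: "y \<in> span (range ((*v) A))"
      and z: "\<And>w. w \<in> span (range ((*v) A)) \<Longrightarrow> orthogonal z w" and b: "b = y + z"
      using orthogonal_subspace_decomp_exists[of "range ((*v) A)" b] by blast
    have "subspace (range ((*v) A))"
      by (simp add: linear_subspace_image)
    then obtain x where x: "y = A *v x"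
      using y by (auto simp: span_eq_iff[THEN iffD2])
    have "(transpose A *v z) \<bullet> w = 0" for w
      using z[of "A *v w"] by (simp add: span_base orthogonal_def dot_lmul_matrix)
    then have "transpose A *v z = 0"
      using inner_eq_zero_iff by blast
    then show ?thesis
      using x b by (metis add.right_neutral matrix_vector_right_distrib)
  qed
  then obtain f where f: "\<And>b. transpose A *v (A *v f b) = transpose A *v b"
    by metis
  define Y where "Y = (\<chi> i j. f (axis j 1) $ i)"
  have "(transpose A ** A ** Y) $ i $ j = transpose A $ i $ j" for i j
  proof -
    have "(transpose A ** A ** Y) $ i $ j = (transpose A ** A *v f (axis j 1)) $ i"
      by (simp add: matrix_matrix_mult_def matrix_vector_mult_def Y_def)
    also have "\<dots> = (transpose A *v axis j 1) $ i"
      using f by (simp add: matrix_vector_mul_assoc)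
    also have "\<dots> = transpose A $ i $ j"
      by (simp add: matrix_vector_mult_basis column_def)
    finally show ?thesis .
  qed
  then show ?thesis
    by (auto simp: vec_eq_iff)
qed

text \<open>Transposing the normal equations gives
  \<open>transpose Y ** transpose A ** A = A\<close>. Multiplying this by \<open>Y\<close> on the
  right and using the normal equations again shows
  \<open>A ** Y = transpose Y ** transpose A\<close>, which is the symmetry.\<close>

lemma one_three_inverse_exists:
  fixes A :: "real^'m^'n"
  shows "\<exists>Y. A ** Y ** A = A \<and> transpose (A ** Y) = A ** Y"
proof -
  obtain Y where Y: "transpose A ** A ** Y = transpose A"
    using normal_equations_solvable by blast
  then have YA: "transpose Y ** transpose A ** A = A"
    by (metis matrix_mul_assoc matrix_transpose_mul transpose_transpose)
  then have sym: "transpose (A ** Y) = A ** Y"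
    by (metis Y matrix_mul_assoc matrix_transpose_mul)
  then have "A ** Y ** A = A"
    using YA by (metis matrix_transpose_mul)
  with sym show ?thesis by blast
qed

text \<open>Urquhart's formula: if \<open>Y\<close> is a (1,3)-inverse and \<open>W\<close> a (1,4)-inverse of \<open>A\<close>, then \<open>W A Y\<close> is the
  Moore--Penrose inverse.\<close>

lemma moore_penrose_inverse:
  fixes A :: "real^'m^'n"
  defines "X \<equiv> moore_penrose_inverse A"
  shows "A ** X ** A = A" and "X ** A ** X = X"
    and "transpose (A ** X) = A ** X" and "transpose (X ** A) = X ** A"
proof -
  let ?mp = "\<lambda>X. A ** X ** A = A \<and> X ** A ** X = X \<and>
     transpose (A ** X) = A ** X \<and> transpose (X ** A) = X ** A"
  obtain Y where Y: "A ** Y ** A = A" "transpose (A ** Y) = A ** Y"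
    using one_three_inverse_exists by blast
  \<comment> \<open>The transpose of a (1,3)-inverse of \<open>transpose A\<close> is a
    (1,4)-inverse of \<open>A\<close>.\<close>
  obtain Z where "transpose A ** Z ** transpose A = transpose A"
    "transpose (transpose A ** Z) = transpose A ** Z"
    using one_three_inverse_exists by blast
  then have W: "A ** transpose Z ** A = A" "transpose (transpose Z ** A) = transpose Z ** A"
    by (metis matrix_mul_assoc matrix_transpose_mul transpose_transpose)+
  define X0 where "X0 = transpose Z ** A ** Y"
  have AX: "A ** X0 = A ** Y" and XA: "X0 ** A = transpose Z ** A"
    using W(1) Y(1) by (metis X0_def matrix_mul_assoc)+
  have "X0 ** A ** X0 = X0"
    using XA W(1) by (metis X0_def matrix_mul_assoc)
  then have ex: "?mp X0"
    using AX XA Y W by simp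
  \<comment> \<open>\<open>A ** X1\<close> and \<open>A ** X2\<close> are symmetric idempotents with
    the same range. Transposing \<open>A ** X2 ** (A ** X1) = A ** X1\<close> swaps the factors and
    identifies them, and similarly for the products on the other side.\<close>
  have uniq: "X1 = X2" if "?mp X1" "?mp X2" for X1 X2
  proof -
    have "A ** X1 = transpose (A ** X2 ** (A ** X1))"
      using that by (simp add: matrix_mul_assoc)
    also have "\<dots> = A ** X1 ** (A ** X2)"
      using that by (metis matrix_transpose_mul)
    also have "\<dots> = A ** X2"
      using that by (simp add: matrix_mul_assoc)
    finally have l: "A ** X1 = A ** X2" .
    have "X1 ** A = transpose (X1 ** A ** (X2 ** A))"
      using that by (metis matrix_mul_assoc)
    also have "\<dots> = X2 ** A ** (X1 ** A)"
      using that by (metis matrix_transpose_mul)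
    also have "\<dots> = X2 ** A"
      using that by (metis matrix_mul_assoc)
    finally have r: "X1 ** A = X2 ** A" .
    have "X1 = X1 ** (A ** X1)"
      using that by (simp add: matrix_mul_assoc)
    also have "\<dots> = X2 ** A ** X2"
      using l r by (simp add: matrix_mul_assoc)
    finally show ?thesis
      using that by simp
  qed
  have "?mp X"
    unfolding X_def moore_penrose_inverse_def by (rule theI[of ?mp]) (use ex uniq in blast)+
  then show "A ** X ** A = A" and "X ** A ** X = X"
    and "transpose (A ** X) = A ** X" and "transpose (X ** A) = X ** A"
    by blast+
qed

subsection \<open>Search directions\<close>

text \<open>This is the null space of the transposed bar part of \<open>nbas P x\<close>,
  zero-padded to full size. Adding such a vector to v(x) preserves both tangency and the hat
  part.\<close>

definition tcg_space :: "('n::finite, 'c::finite) rpn_problem \<Rightarrow> real \<Rightarrow> real^'n \<Rightarrow> (real^'n) set" where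
  "tcg_space P t x = {u. (\<forall>i. i \<notin> act_set P t x \<longrightarrow> u $ i = 0) \<and> transpose (nbas P x) *v u = 0}"

lemma subspace_tcg_space: "subspace (tcg_space P t x)"
  by (auto simp: subspace_def tcg_space_def matrix_vector_right_distrib
      vector_scaleR_matrix_ac[symmetric] matrix_vector_mult_scaleR simp del: transpose_matrix_vector)

text \<open>With \<open>B\<close> the bar part of the normal basis, \<open>B ** X\<close> is the
  orthogonal projection onto the range of \<open>B\<close>, so subtracting it from the identity on
  the active coordinates leaves vectors killed by \<open>transpose B\<close>.\<close>

lemma Pproj_in_tcg_space: "Pproj P t x *v y \<in> tcg_space P t x"
proof -
  define J where "J = act_set P t x"
  define B where "B = part J (nbas P x)"
  define X where "X = moore_penrose_inverse B"
  define Q :: "real^'a^'a" where "Q = block J J (mat 1)"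
  have PQ: "Pproj P t x = Q - B ** X"
    by (simp add: Pproj_def Let_def Q_def B_def J_def X_def)
  have supp: "(Pproj P t x *v y) $ i = 0" if "i \<notin> J" for i
    using that
    by (simp add: PQ matrix_vector_mult_def matrix_matrix_mult_def Q_def B_def block_def part_def)
  have "transpose (nbas P x) *v u = transpose B *v u" if "\<And>i. i \<notin> J \<Longrightarrow> u $ i = 0" for u
    using that
    by (auto simp: vec_eq_iff matrix_vector_mult_def transpose_def B_def part_def
        simp del: transpose_matrix_vector intro!: sum.cong)
  then have "transpose (nbas P x) *v (Pproj P t x *v y) = transpose B *v (Pproj P t x *v y)"
    using supp by blast
  also have "\<dots> = (transpose B ** Q) *v y - (transpose B ** (B ** X)) *v y"
    by (simp add: PQ matrix_vector_mult_diff_rdistrib matrix_vector_mult_diff_distrib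
        matrix_vector_mul_assoc del: transpose_matrix_vector)
  also have "transpose B ** Q = transpose B"
  proof -
    have "transpose B $ i $ k * Q $ k $ j = (if k = j then B $ k $ i else 0)" for i j k
      by (simp add: transpose_def Q_def B_def block_def part_def mat_def)
    then show ?thesis
      by (simp add: vec_eq_iff matrix_matrix_mult_def transpose_def)
  qed
  \<comment> \<open>The transpose of \<open>B ** X ** B = B\<close>, with \<open>B ** X\<close>
    symmetric.\<close>
  also have "transpose B ** (B ** X) = transpose B"
    using moore_penrose_inverse(1,3)[of B] unfolding X_def by (metis matrix_transpose_mul)
  finally have "transpose (nbas P x) *v (Pproj P t x *v y) = 0"
    by simp
  then show ?thesis
    using supp by (simp add: tcg_space_def J_def)
qed

definition model_ok :: "('n::finite, 'c::finite) rpn_problem \<Rightarrow> rpn_params \<Rightarrow> real \<Rightarrow> real^'n \<Rightarrow> real^'n \<Rightarrow> bool"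
  where "model_ok P A t x d \<longleftrightarrow> \<not> low_curv P A t x d \<and> Gmod P A t x d \<le> Gmod P A t x 0"

text \<open>All vectors of the CG iteration stay in the null space of the constraint; the returned iterate is
  either the initial \<open>0\<close> or one that has passed the tests in an earlier round.\<close>

lemma tcg_loop_result:
  assumes "tcg_loop P A t x r0 w r p \<delta> w' st"
    and "w \<in> tcg_space P t x" "r \<in> tcg_space P t x" "p \<in> tcg_space P t x"
    and "w = 0 \<or> model_ok P A t x (comb P t x w)"
  shows "w' \<in> tcg_space P t x \<and> (w' = 0 \<or> model_ok P A t x (comb P t x w'))"
  using assms
proof induction
  case (conv q p \<delta> a r w1 w r1)
  then show ?case
    using subspace_tcg_space[of P t x]
    by (auto simp: model_ok_def not_less intro: subspace_add subspace_scale)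
next
  case (iter q p \<delta> a r w1 w r1 b p1 \<delta>1 w' st)
  have q: "q \<in> tcg_space P t x"
    using iter.hyps(1) Pproj_in_tcg_space by simp
  have w1: "w1 \<in> tcg_space P t x"
    unfolding iter.hyps(4) using iter.prems subspace_tcg_space
    by (intro subspace_add subspace_scale)
  have r1: "r1 \<in> tcg_space P t x"
    unfolding iter.hyps(5) using iter.prems q subspace_tcg_space
    by (intro subspace_add subspace_scale)
  have p1: "p1 \<in> tcg_space P t x"
    unfolding iter.hyps(9) using iter.prems r1 subspace_tcg_space
    by (intro subspace_add subspace_scale subspace_neg)
  have "model_ok P A t x (comb P t x w1)"
    using iter.hyps(6) by (simp add: model_ok_def)
  then show ?case
    by (intro iter.IH w1 r1 p1 disjI2)
qed auto

text \<open>The alternative \<open>w = 0\<close> includes the exits Early1 and Early2, where the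
  direction is v(x) itself and has failed a test. Its descent must then come from the proximal
  step.\<close>

lemma tcg_result:
  assumes "tcg P A t x w st"
  shows "w \<in> tcg_space P t x \<and> (w = 0 \<or> model_ok P A t x (comb P t x w))"
  using assms
proof cases
  case (loop r0)
  have "r0 \<in> tcg_space P t x"
    using loop(3) Pproj_in_tcg_space by simp
  then show ?thesis
    using loop(4) subspace_tcg_space[of P t x]
    by (intro tcg_loop_result[of P A t x r0 0 r0 "- r0" "r0 \<bullet> r0"])
       (auto intro: subspace_neg subspace_0)
qed (use subspace_tcg_space in \<open>auto intro: subspace_0\<close>)

text \<open>Being orthogonal to the columns of \<open>B\<close> means being orthogonal to the normal
  space, and a subspace equals its double orthogonal complement.\<close>

lemma tangent_spaceI:
  assumes "subspace (tangent_space M x)" and "orthonormal_normal_basis M x B"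
    and "transpose B *v u = 0"
  shows "u \<in> tangent_space M x"
proof -
  have "orthogonal b u" if "b \<in> columns B" for b
  proof -
    obtain k where "b = column k B"
      using \<open>b \<in> columns B\<close> by (auto simp: columns_def)
    then have "b \<bullet> u = (transpose B *v u) $ k"
      by (simp add: inner_vec_def matrix_vector_mult_def column_def transpose_def
          del: transpose_matrix_vector)
    with assms(3) show ?thesis
      by (simp add: orthogonal_def)
  qed
  then have "orthogonal b u" if "b \<in> span (columns B)" for b
    using that orthogonal_to_span orthogonal_commute by blast
  then have "u \<in> orthogonal_comp (orthogonal_comp (tangent_space M x))"
    using assms(2) by (simp add: orthogonal_comp_def orthonormal_normal_basis_def normal_space_def)
  then show ?thesis
    using assms(1) by (simp add: orthogonal_comp_self)
qed

section \<open>Decrease of the linearized objective along proximal and truncated CG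
  directions\<close>

lemma soft_threshold_minimal:
  fixes a y z :: real
  assumes "a \<ge> 0"
  defines "s \<equiv> max (\<bar>z\<bar> - a) 0 * sgn z"
  shows "(s - z)\<^sup>2 / 2 + a * \<bar>s\<bar> \<le> (y - z)\<^sup>2 / 2 + a * \<bar>y\<bar>"
proof (cases "\<bar>z\<bar> \<le> a")
  case True
  have "y * z \<le> \<bar>y\<bar> * \<bar>z\<bar>"
    by (metis abs_ge_self abs_mult)
  also have "\<dots> \<le> a * \<bar>y\<bar>"
    using mult_right_mono[OF True abs_ge_zero[of y]] by (simp add: mult.commute)
  finally have "y * z \<le> a * \<bar>y\<bar>" .
  moreover have "s = 0"
    using True by (simp add: s_def)
  moreover have "(y - z)\<^sup>2 = y\<^sup>2 - 2 * (y * z) + z\<^sup>2"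
    by (simp add: power2_diff)
  ultimately show ?thesis
    using zero_le_power2[of y] by (simp add: add_divide_distrib diff_divide_distrib)
next
  case False
  have s: "\<bar>s\<bar> = \<bar>z\<bar> - a" "(s - z)\<^sup>2 = a\<^sup>2"
    using False assms(1) by (auto simp: s_def sgn_if power2_eq_square algebra_simps)
  \<comment> \<open>The left side is the objective value at \<open>s\<close>. On the right,
    \<bar>y\<bar> is replaced by its linear minorant \<open>sgn z * y\<close>, so that completing
    the square suffices.\<close>
  have "a * \<bar>z\<bar> - a\<^sup>2 / 2 \<le> (y - z)\<^sup>2 / 2 + a * (sgn z * y)"
  proof -
    have "0 \<le> (sgn z * (y - z) + a)\<^sup>2"
      by simp
    also have "\<dots> = (y - z)\<^sup>2 + 2 * a * (sgn z * y) - 2 * a * \<bar>z\<bar> + a\<^sup>2"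
      using False assms(1) by (auto simp: power2_eq_square sgn_if algebra_simps)
    finally show ?thesis by simp
  qed
  moreover have "a * (sgn z * y) \<le> a * \<bar>y\<bar>"
    using assms(1) by (intro mult_left_mono) (auto simp: sgn_if)
  moreover have "a * \<bar>s\<bar> = a * \<bar>z\<bar> - a\<^sup>2"
    using s(1) by (simp add: power2_eq_square right_diff_distrib)
  ultimately show ?thesis
    using s(2) by linarith
qed

text \<open>The multiplier identity turns x + v into an unconstrained separable proximal point,
  which is compared coordinatewise with the competitor x. The normal term of \<open>g\<close> drops
  out because v is orthogonal to the columns of \<open>nbas P x\<close>.\<close>

lemma pg_dir_decrease:
  assumes "is_multiplier P t x l" and "t > 0" and "mu P \<ge> 0"
  defines "v \<equiv> pg_dir P t x"
  shows "grad P x \<bullet> v + hreg P (x + v) - hreg P x \<le> - (norm v)\<^sup>2 / (2 * t)"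
proof -
  define g where "g = grad P x + nbas P x *v l"
  have v: "x + v = prox P t (x - t *\<^sub>R g)" and Bv: "transpose (nbas P x) *v v = 0"
    using assms(1) by (auto simp: is_multiplier_def v_def g_def)
  \<comment> \<open>Relative to the proximal centre, x + v has offset v + t g and x has offset t g.
    The squares of t g cancel.\<close>
  have "(v $ i)\<^sup>2 / 2 + t * (g $ i * v $ i) + t * mu P * \<bar>(x + v) $ i\<bar> \<le> t * mu P * \<bar>x $ i\<bar>" for i
  proof -
    have "(x + v) $ i = max (\<bar>(x - t *\<^sub>R g) $ i\<bar> - t * mu P) 0 * sgn ((x - t *\<^sub>R g) $ i)"
      using v by (simp add: prox_def)
    moreover have "t * mu P \<ge> 0"
      using assms(2,3) by simp
    ultimately have "((x + v) $ i - (x - t *\<^sub>R g) $ i)\<^sup>2 / 2 + t * mu P * \<bar>(x + v) $ i\<bar>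
        \<le> (x $ i - (x - t *\<^sub>R g) $ i)\<^sup>2 / 2 + t * mu P * \<bar>x $ i\<bar>"
      using soft_threshold_minimal[of "t * mu P" "(x - t *\<^sub>R g) $ i" "x $ i"] by presburger
    then show ?thesis
      by (simp add: power2_eq_square algebra_simps add_divide_distrib diff_divide_distrib)
  qed
  then have "(\<Sum>i\<in>UNIV. (v $ i)\<^sup>2 / 2 + t * (g $ i * v $ i) + t * mu P * \<bar>(x + v) $ i\<bar>)
      \<le> (\<Sum>i\<in>UNIV. t * mu P * \<bar>x $ i\<bar>)"
    by (rule sum_mono)
  moreover have "(norm v)\<^sup>2 = (\<Sum>i\<in>UNIV. (v $ i)\<^sup>2)"
    unfolding power2_norm_eq_inner inner_vec_def by (simp add: power2_eq_square)
  ultimately have "(norm v)\<^sup>2 / 2 + t * (g \<bullet> v) + t * hreg P (x + v) \<le> t * hreg P x"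
    by (simp add: hreg_def inner_vec_def sum.distrib sum_distrib_left sum_divide_distrib mult.assoc)
  moreover have "g \<bullet> v = grad P x \<bullet> v"
  proof -
    have "(nbas P x *v l) \<bullet> v = (v v* nbas P x) \<bullet> l"
      by (metis dot_lmul_matrix inner_commute)
    then show ?thesis
      using Bv by (simp add: g_def inner_add_left)
  qed
  ultimately show ?thesis
    using \<open>t > 0\<close> by (simp add: field_simps)
qed

text \<open>Model decrease bounds the left side by minus half the regularized curvature, and the
  curvature test bounds the latter below. The second assumption matches the two tests: the model
  uses the hat part of d, the curvature test that of v(x).\<close>

lemma model_ok_decrease:
  assumes "model_ok P A t x d" and "part (- act_set P t x) d = vhat P t x"
  shows "grad P x \<bullet> d + hreg P (x + d) - hreg P x \<le> - (gam A / 2) * (norm d)\<^sup>2"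
proof -
  have "part (- act_set P t x) 0 = (0::real^'a)"
    by (simp add: part_def vec_eq_iff)
  with assms show ?thesis
    by (simp add: model_ok_def low_curv_def Gmod_def not_less)
qed

text \<open>The upper bound \<open>tb\<close> replaces 1 / (2 t) by a constant that does not change
  with t, hence not with the iteration.\<close>

lemma search_dir_properties:
  assumes T: "subspace (tangent_space (man P) x)"
    and basis: "orthonormal_normal_basis (man P) x (nbas P x)"
    and mult: "is_multiplier P t x l" and "0 < t" "t \<le> tb" and "mu P \<ge> 0"
    and d: "search_dir P A t x d st"
  shows "d \<in> tangent_space (man P) x"
    and "grad P x \<bullet> d + hreg P (x + d) - hreg P x \<le> - min (gam A / 2) (1 / (2 * tb)) * (norm d)\<^sup>2"
proof -
  obtain w where "tcg P A t x w st" and dw: "d = comb P t x w"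
    using d by (auto simp: search_dir_def)
  then have w: "w \<in> tcg_space P t x" and ok: "w = 0 \<or> model_ok P A t x d"
    using tcg_result by blast+
  have dv: "d = pg_dir P t x + w"
    by (auto simp: dw comb_def vbar_def vhat_def part_def vec_eq_iff)
  have "transpose (nbas P x) *v d = 0"
  proof -
    have "transpose (nbas P x) *v w = 0" "transpose (nbas P x) *v pg_dir P t x = 0"
      using w mult unfolding tcg_space_def is_multiplier_def by blast+
    then show ?thesis
      by (simp add: dv matrix_vector_right_distrib del: transpose_matrix_vector)
  qed
  then show "d \<in> tangent_space (man P) x"
    using T basis by (intro tangent_spaceI)
  show "grad P x \<bullet> d + hreg P (x + d) - hreg P x \<le> - min (gam A / 2) (1 / (2 * tb)) * (norm d)\<^sup>2"
    using ok
  proof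
    assume "w = 0"
    then have "grad P x \<bullet> d + hreg P (x + d) - hreg P x \<le> - (norm d)\<^sup>2 / (2 * t)"
      using pg_dir_decrease[OF mult] assms dv by simp
    also have "\<dots> \<le> - (1 / (2 * tb)) * (norm d)\<^sup>2"
      using assms by (simp add: frac_le)
    also have "\<dots> \<le> - min (gam A / 2) (1 / (2 * tb)) * (norm d)\<^sup>2"
      by (intro mult_right_mono) auto
    finally show ?thesis .
  next
    assume "model_ok P A t x d"
    moreover have "part (- act_set P t x) d = vhat P t x"
      using w by (auto simp: dv vhat_def part_def tcg_space_def vec_eq_iff)
    ultimately have "grad P x \<bullet> d + hreg P (x + d) - hreg P x \<le> - (gam A / 2) * (norm d)\<^sup>2"
      by (rule model_ok_decrease)
    also have "\<dots> \<le> - min (gam A / 2) (1 / (2 * tb)) * (norm d)\<^sup>2"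
      by (intro mult_right_mono) auto
    finally show ?thesis .
  qed
qed

subsection \<open>Sufficient descent\<close>

lemma hreg_lipschitz:
  fixes P :: "('n::finite, 'c::finite) rpn_problem"
  assumes "mu P \<ge> 0"
  shows "hreg P a - hreg P b \<le> mu P * CARD('n) * norm (a - b)"
proof -
  have "hreg P a - hreg P b = mu P * (\<Sum>i\<in>UNIV. \<bar>a $ i\<bar> - \<bar>b $ i\<bar>)"
    by (simp add: hreg_def sum_subtractf right_diff_distrib)
  also have "\<dots> \<le> mu P * (\<Sum>i\<in>(UNIV::'n set). norm (a - b))"
  proof (intro mult_left_mono sum_mono assms)
    show "\<bar>a $ i\<bar> - \<bar>b $ i\<bar> \<le> norm (a - b)" for i
      using component_le_norm_cart[of "a - b" i] by simp
  qed
  finally show ?thesis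
    by simp
qed

lemma hreg_convex:
  assumes "mu P \<ge> 0" and "0 \<le> \<alpha>" "\<alpha> \<le> 1"
  shows "hreg P (x + \<alpha> *\<^sub>R d) \<le> hreg P x + \<alpha> * (hreg P (x + d) - hreg P x)"
proof -
  have "\<bar>(x + \<alpha> *\<^sub>R d) $ i\<bar> \<le> (1 - \<alpha>) * \<bar>x $ i\<bar> + \<alpha> * \<bar>(x + d) $ i\<bar>" for i
  proof -
    have "(x + \<alpha> *\<^sub>R d) $ i = (1 - \<alpha>) * x $ i + \<alpha> * (x + d) $ i"
      by (simp add: algebra_simps)
    also have "\<bar>\<dots>\<bar> \<le> \<bar>(1 - \<alpha>) * x $ i\<bar> + \<bar>\<alpha> * (x + d) $ i\<bar>"
      by (rule abs_triangle_ineq)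
    finally show ?thesis
      using assms by (simp add: abs_mult)
  qed
  then have "hreg P (x + \<alpha> *\<^sub>R d) \<le> mu P * (\<Sum>i\<in>UNIV. (1 - \<alpha>) * \<bar>x $ i\<bar> + \<alpha> * \<bar>(x + d) $ i\<bar>)"
    unfolding hreg_def by (intro mult_left_mono sum_mono assms)
  also have "\<dots> = (1 - \<alpha>) * hreg P x + \<alpha> * hreg P (x + d)"
    by (simp add: hreg_def sum.distrib distrib_left sum_distrib_left[symmetric] mult.left_commute)
  finally show ?thesis
    by (simp add: algebra_simps)
qed

text \<open>The mean value inequality on the segment yields the factor L instead of L / 2, which
  only affects the size of the admissible steps.\<close>

lemma lipschitz_gradient_bound:
  fixes f :: "'a::real_inner \<Rightarrow> real"
  assumes f: "\<And>x. GDERIV f x :> g x" and L: "L-lipschitz_on UNIV g"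
  shows "f y - f x \<le> g x \<bullet> (y - x) + L * (norm (y - x))\<^sup>2"
proof -
  let ?S = "closed_segment x y"
  have "norm (f y - f x - (\<lambda>z h. h \<bullet> g z) x (y - x)) \<le> norm (y - x) * (L * norm (y - x))"
  proof (rule differentiable_bound_linearization[where S = ?S and f' = "\<lambda>z h. h \<bullet> g z" and ?x0.0 = x])
    show "x + t *\<^sub>R (y - x) \<in> ?S" if "t \<in> {0..1}" for t :: real
      using that by (auto simp: closed_segment_def algebra_simps intro!: exI[of _ t])
    show "(f has_derivative (\<lambda>h. h \<bullet> g z)) (at z within ?S)" for z
      using f[of z] by (auto simp: gderiv_def intro: has_derivative_at_withinI)
    show "onorm ((\<lambda>h. h \<bullet> g z) - (\<lambda>h. h \<bullet> g x)) \<le> L * norm (y - x)" if "z \<in> ?S" for z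
    proof (rule onorm_bound)
      show "0 \<le> L * norm (y - x)"
        using lipschitz_on_nonneg[OF L] by simp
      fix h
      have "norm (((\<lambda>h. h \<bullet> g z) - (\<lambda>h. h \<bullet> g x)) h) = \<bar>h \<bullet> (g z - g x)\<bar>"
        by (simp add: inner_diff_right)
      also have "\<dots> \<le> norm h * norm (g z - g x)"
        by (rule Cauchy_Schwarz_ineq2)
      also have "\<dots> \<le> norm h * (L * norm (y - x))"
      proof (rule mult_left_mono)
        have "norm (g z - g x) \<le> L * norm (z - x)"
          using lipschitz_onD[OF L, of z x] by (simp add: dist_norm)
        also have "\<dots> \<le> L * norm (y - x)"
          using segment_bound1[OF that] lipschitz_on_nonneg[OF L] by (intro mult_left_mono)
        finally show "norm (g z - g x) \<le> L * norm (y - x)" .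
      qed simp
      finally show "norm (((\<lambda>h. h \<bullet> g z) - (\<lambda>h. h \<bullet> g x)) h) \<le> L * norm (y - x) * norm h"
        by (simp add: mult.commute)
    qed
  qed auto
  then show ?thesis
    by (simp add: power2_eq_square inner_commute mult.commute mult.left_commute abs_le_iff)
qed

text \<open>The retraction is split into the straight step \<alpha> d and an error \<open>e\<close>
  of second order. Convexity of h, for \<alpha> \<le> 1, handles the straight step, its Lipschitz
  constant handles \<open>e\<close>, and the first-order bound \<open>R1\<close> controls the
  quadratic remainder of f.\<close>

lemma Fobj_retr_le:
  fixes P :: "('n::finite, 'c::finite) rpn_problem"
  assumes "\<And>x. GDERIV (fsm P) x :> grad P x" and L: "L-lipschitz_on UNIV (grad P)"
    and "mu P \<ge> 0" and "norm (grad P x) \<le> G"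
    and R2: "norm (retr P x (\<alpha> *\<^sub>R d) - x - \<alpha> *\<^sub>R d) \<le> C * (norm (\<alpha> *\<^sub>R d))\<^sup>2"
    and R1: "norm (retr P x (\<alpha> *\<^sub>R d) - x) \<le> C * norm (\<alpha> *\<^sub>R d)"
    and \<alpha>: "0 \<le> \<alpha>" "\<alpha> \<le> 1"
  shows "Fobj P (retr P x (\<alpha> *\<^sub>R d)) \<le> Fobj P x
    + \<alpha> * (grad P x \<bullet> d + hreg P (x + d) - hreg P x)
    + (G * C + L * C\<^sup>2 + mu P * CARD('n) * C) * (\<alpha> * norm d)\<^sup>2"
proof -
  define y where "y = retr P x (\<alpha> *\<^sub>R d)"
  define e where "e = y - x - \<alpha> *\<^sub>R d"
  define q where "q = (\<alpha> * norm d)\<^sup>2"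
  have e: "norm e \<le> C * q"
    using R2 \<alpha> by (simp add: e_def y_def q_def)
  have "(norm (y - x))\<^sup>2 \<le> (C * norm (\<alpha> *\<^sub>R d))\<^sup>2"
    using R1 unfolding y_def by (intro power_mono) auto
  then have yx: "(norm (y - x))\<^sup>2 \<le> C\<^sup>2 * q"
    using \<alpha> by (simp add: q_def power_mult_distrib)
  have "grad P x \<bullet> e \<le> norm (grad P x) * norm e"
    by (rule norm_cauchy_schwarz)
  also have "\<dots> \<le> G * (C * q)"
    using e assms(4) order_trans[OF norm_ge_zero assms(4)] by (intro mult_mono) auto
  finally have ge: "grad P x \<bullet> e \<le> G * (C * q)" .
  have "y - x = \<alpha> *\<^sub>R d + e"
    by (simp add: e_def)
  then have "grad P x \<bullet> (y - x) = \<alpha> * (grad P x \<bullet> d) + grad P x \<bullet> e"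
    by (simp add: inner_add_right)
  moreover have "fsm P y - fsm P x \<le> grad P x \<bullet> (y - x) + L * (norm (y - x))\<^sup>2"
    using assms(1) L by (rule lipschitz_gradient_bound)
  moreover have "L * (norm (y - x))\<^sup>2 \<le> L * (C\<^sup>2 * q)"
    using yx lipschitz_on_nonneg[OF L] by (rule mult_left_mono)
  ultimately have f: "fsm P y - fsm P x \<le> \<alpha> * (grad P x \<bullet> d) + G * (C * q) + L * (C\<^sup>2 * q)"
    using ge by linarith
  have "hreg P y - hreg P (x + \<alpha> *\<^sub>R d) \<le> mu P * CARD('n) * norm e"
    using hreg_lipschitz[OF \<open>mu P \<ge> 0\<close>, of y "x + \<alpha> *\<^sub>R d"] by (simp add: e_def diff_diff_eq)
  also have "\<dots> \<le> mu P * CARD('n) * (C * q)"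
    using e \<open>mu P \<ge> 0\<close> by (intro mult_left_mono) auto
  finally have "hreg P y \<le> hreg P x + \<alpha> * (hreg P (x + d) - hreg P x) + mu P * CARD('n) * (C * q)"
    using hreg_convex[OF \<open>mu P \<ge> 0\<close> \<alpha>, of x d] by linarith
  with f have "Fobj P y \<le> Fobj P x + \<alpha> * (grad P x \<bullet> d) + \<alpha> * (hreg P (x + d) - hreg P x)
      + (G * (C * q) + L * (C\<^sup>2 * q) + mu P * CARD('n) * (C * q))"
    by (simp add: Fobj_def)
  then show ?thesis
    unfolding y_def[symmetric] q_def[symmetric] by (simp add: algebra_simps)
qed

text \<open>If the first trial is accepted, the step is \<open>ainit A\<close>. Otherwise the
  previous trial was rejected, hence at least \<open>abar\<close>, and the accepted step is
  \<open>rho2 A\<close> times it.\<close>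

lemma backtrack_lower_bound:
  assumes "backtrack P A \<rho>1 x d \<alpha>" and "0 < ainit A" and "0 < rho2 A" "rho2 A < 1"
    and "abar \<le> ainit A"
    and "\<And>\<alpha>. 0 < \<alpha> \<Longrightarrow> \<alpha> < abar \<Longrightarrow> suff_descent P \<rho>1 x d \<alpha>"
  shows "abar * rho2 A \<le> \<alpha>"
proof -
  obtain m where m: "\<alpha> = ainit A * rho2 A ^ m"
    and rej: "\<And>i. i < m \<Longrightarrow> \<not> suff_descent P \<rho>1 x d (ainit A * rho2 A ^ i)"
    using assms(1) by (auto simp: backtrack_def)
  show ?thesis
  proof (cases m)
    case 0
    have "abar * rho2 A \<le> ainit A * 1"
      using assms by (intro mult_mono) auto
    then show ?thesis
      using m 0 by simp
  next
    case (Suc i)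
    have "0 < ainit A * rho2 A ^ i"
      using assms by simp
    then have "abar \<le> ainit A * rho2 A ^ i"
      using rej[of i] assms(6) Suc by force
    then have "abar * rho2 A \<le> ainit A * rho2 A ^ i * rho2 A"
      using assms(3) by (intro mult_right_mono) auto
    then show ?thesis
      using m Suc by (simp add: mult_ac)
  qed
qed

subsection \<open>Reachable states\<close>

lemma next_t_bounds:
  assumes "tmin A \<le> t" "t \<le> tmax A" and "0 < tmin A" "varpi1 A > 1" "varpi2 A < 1"
  shows "tmin A \<le> next_t A t v d st \<and> next_t A t v d st \<le> tmax A"
proof -
  \<comment> \<open>Each update clips on one side only. The other side follows since the factor
    moves t away from that bound.\<close>
  have "varpi2 A * t \<le> 1 * t" "1 * t \<le> varpi1 A * t"
    using assms by (intro mult_right_mono; simp)+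
  then have "varpi2 A * t \<le> tmax A" "tmin A \<le> varpi1 A * t"
    using assms by linarith+
  with assms show ?thesis
    by (auto simp: next_t_def)
qed

text \<open>The second conjunct serves a rejected full step, which backtracks from index k - 1 along
  a stored direction: that direction must be a truncated CG output there, and
  \<open>idx s \<noteq> 0\<close> keeps natural subtraction from truncating.\<close>

definition rpn_inv :: "('n::finite, 'c::finite) rpn_problem \<Rightarrow> rpn_params \<Rightarrow> 'n rpn_state \<Rightarrow> bool" where
  "rpn_inv P A s \<longleftrightarrow>
     (\<forall>i\<le>idx s. xs s i \<in> man P \<and> tmin A \<le> ts s i \<and> ts s i \<le> tmax A) \<and>
     (flag s \<noteq> 0 \<longrightarrow> idx s \<noteq> 0 \<and>
        (\<exists>st. search_dir P A (ts s (idx s - 1)) (xs s (idx s - 1)) (ds s (idx s - 1)) st))"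

lemma rpn_inv_step:
  assumes inv: "rpn_inv P A s" and "rpn_step P A \<rho>1 s lab s'"
    and par: "0 < tmin A" "varpi1 A > 1" "varpi2 A < 1"
    and retr: "\<And>t x d st \<alpha>. tmin A \<le> t \<Longrightarrow> t \<le> tmax A \<Longrightarrow> x \<in> man P \<Longrightarrow> search_dir P A t x d st \<Longrightarrow>
      retr P x (\<alpha> *\<^sub>R d) \<in> man P"
  shows "rpn_inv P A s'"
proof -
  have retr1: "retr P x d \<in> man P"
    if "tmin A \<le> t" "t \<le> tmax A" "x \<in> man P" "search_dir P A t x d st" for t x d st
    using retr[OF that, of 1] by simp
  have old: "xs s i \<in> man P" "tmin A \<le> ts s i" "ts s i \<le> tmax A" if "i \<le> idx s" for i
    using inv that by (auto simp: rpn_inv_def)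
  have new: "tmin A \<le> next_t A (ts s (idx s)) v d st" "next_t A (ts s (idx s)) v d st \<le> tmax A" for v d st
    using next_t_bounds[of A "ts s (idx s)"] old[of "idx s"] par by auto
  from assms(2) show ?thesis
  proof cases
    case (linesearch k x t d st t1 \<alpha>)
    have "retr P x (\<alpha> *\<^sub>R d) \<in> man P"
      using linesearch old by (intro retr) auto
    then show ?thesis
      using linesearch old new by (auto simp: rpn_inv_def le_Suc_eq)
  next
    case (full_first k x t d st t1)
    have "retr P x d \<in> man P"
      using full_first old by (intro retr1) auto
    then show ?thesis
      using full_first old new by (auto simp: rpn_inv_def le_Suc_eq)
  next
    case (full_accept k x t d st t1 y xp vp)
    have "y \<in> man P"
      using full_accept old by (auto intro: retr1)
    then show ?thesis
      using full_accept old new by (auto simp: rpn_inv_def le_Suc_eq)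
  next
    \<comment> \<open>The index stays at k. The discarded point \<open>y\<close> sits at k + 1,
      beyond the range of the invariant, and entry k is overwritten by a retracted point.\<close>
    case (full_reject k x t d st t1 y xp vp dp \<alpha>)
    obtain st' where "search_dir P A (ts s (k - 1)) xp dp st'"
      using inv full_reject by (auto simp: rpn_inv_def)
    then have "retr P xp (\<alpha> *\<^sub>R dp) \<in> man P"
      using full_reject old[of "k - 1"] by (intro retr) auto
    then show ?thesis
      using full_reject old new by (auto simp: rpn_inv_def)
  qed
qed

lemma rpn_reachable_inv:
  assumes "rpn_reachable P A \<rho>1 x0 t0 s" and "x0 \<in> man P" "tmin A \<le> t0" "t0 \<le> tmax A"
    and "0 < tmin A" "varpi1 A > 1" "varpi2 A < 1"
    and "\<And>t x d st \<alpha>. tmin A \<le> t \<Longrightarrow> t \<le> tmax A \<Longrightarrow> x \<in> man P \<Longrightarrow> search_dir P A t x d st \<Longrightarrow>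
      retr P x (\<alpha> *\<^sub>R d) \<in> man P"
  shows "rpn_inv P A s"
  using assms(1)
proof induction
  case (init s)
  then show ?case
    using assms by (simp add: rpn_inv_def)
next
  case (step s lab s')
  then show ?case
    using assms by (intro rpn_inv_step[of P A s \<rho>1 lab s'])
qed

text \<open>Both line searches, the one at the current iterate and the one after a rejected full
  step, are thereby reduced to the same situation: a feasible point, an admissible t and a truncated
  CG direction.\<close>

lemma rpn_step_backtrack:
  assumes "rpn_step P A \<rho>1 s (Some \<alpha>) s'" and "rpn_inv P A s"
  obtains t x d st where "tmin A \<le> t" "t \<le> tmax A" "x \<in> man P" "search_dir P A t x d st"
    "backtrack P A \<rho>1 x d \<alpha>"
  using assms(1)
proof cases
  case (linesearch k x t d st t1)
  then show thesis
    using assms(2) by (intro that[of t x d st]) (auto simp: rpn_inv_def)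
next
  case (full_reject k x t d st t1 y xp vp dp)
  obtain st' where "search_dir P A (ts s (k - 1)) xp dp st'"
    using assms(2) full_reject by (auto simp: rpn_inv_def)
  then show thesis
    using assms(2) full_reject by (intro that[of "ts s (k - 1)" xp dp st']) (auto simp: rpn_inv_def)
qed

section \<open>Choice of uniform constants and conclusion\<close>

theorem lemma3p1:
  fixes P :: "('n::finite, 'c::finite) rpn_problem"
    and A :: rpn_params
    and m :: nat and x0 :: "real^'n" and t0 :: real
  assumes "compact (man P)"
    and "embedded_submanifold m (man P)"
    and "m + CARD('c) = CARD('n)"
    and "\<And>x. x \<in> man P \<Longrightarrow> orthonormal_normal_basis (man P) x (nbas P x)"
    and "manifold_retraction (man P) (retr P)"
    and "mu P > 0"
    and "\<And>x. GDERIV (fsm P) x :> grad P x"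
    and "\<And>x. (grad P has_derivative (\<lambda>u. hess P x *v u)) (at x)"
    and "continuous_on UNIV (hess P)"
    and "\<exists>L. L-lipschitz_on UNIV (grad P)"
    and "\<And>t x. t > 0 \<Longrightarrow> x \<in> man P \<Longrightarrow> is_multiplier P t x (mult P t x)"
    and "x0 \<in> man P"
    and "ainit A > 0" and "0 < rho2 A" and "rho2 A < 1"
    and "0 < tmin A" and "tmin A \<le> tmax A" and "tmin A \<le> t0" and "t0 \<le> tmax A"
    and "varpi1 A > 1" and "0 < varpi2 A" and "varpi2 A < 1"
    and "vartheta A > 0" and "gam A > 0" and "tau A > 0" and "theta A > 0"
    and "0 < kappa A" and "kappa A < 1"
  shows "\<exists>abar \<rho>1. abar > 0 \<and> 0 < \<rho>1 \<and> \<rho>1 < 1 \<and>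
    (\<forall>s. rpn_reachable P A \<rho>1 x0 t0 s \<longrightarrow>
       (\<forall>d st. search_dir P A (ts s (idx s)) (xs s (idx s)) d st \<longrightarrow>
          (\<forall>\<alpha>. 0 < \<alpha> \<and> \<alpha> < abar \<longrightarrow>
             Fobj P (retr P (xs s (idx s)) (\<alpha> *\<^sub>R d))
               \<le> Fobj P (xs s (idx s)) - \<alpha> * \<rho>1 * (norm d)\<^sup>2)) \<and>
       (\<forall>\<alpha> s'. rpn_step P A \<rho>1 s (Some \<alpha>) s' \<longrightarrow> \<alpha> \<ge> abar * rho2 A))"
proof -
  have T: "subspace (tangent_space (man P) x)" if "x \<in> man P" for x
    using subspace_tangent_space[OF assms(2) that] .
  obtain C where "C \<ge> 0"
    and R2: "\<And>y u. y \<in> man P \<Longrightarrow> u \<in> tangent_space (man P) y \<Longrightarrow>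
      norm (retr P y u - y - u) \<le> C * (norm u)\<^sup>2"
    and R1: "\<And>y u. y \<in> man P \<Longrightarrow> u \<in> tangent_space (man P) y \<Longrightarrow> norm (retr P y u - y) \<le> C * norm u"
    using retraction_bounds[OF assms(5,1) T] by blast
  obtain L where L: "L-lipschitz_on UNIV (grad P)"
    using assms(10) by blast
  have "compact (grad P ` man P)"
    using continuous_on_subset[OF lipschitz_on_continuous_on[OF L] subset_UNIV] assms(1)
    by (rule compact_continuous_image)
  then obtain G where G: "G > 0" "\<And>x. x \<in> man P \<Longrightarrow> norm (grad P x) \<le> G"
    using compact_imp_bounded[of "grad P ` man P"] unfolding bounded_pos by auto
  define c where "c = min (gam A / 2) (1 / (2 * tmax A))"
  define K where "K = G * C + L * C\<^sup>2 + mu P * CARD('n) * C"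
  \<comment> \<open>Half of the decrease \<open>c\<close> is kept for the descent condition, the
    other half absorbs the second-order term with coefficient \<open>K\<close>. The cap 1 / 2 gives
    \<open>\<rho>1 < 1\<close>. All constants are fixed before any run is considered, so the
    dependence of the run on \<rho>1 is not circular.\<close>
  define \<rho>1 where "\<rho>1 = min (c / 2) (1 / 2)"
  \<comment> \<open>The bound 1 allows convexity of h, \<open>ainit A\<close> covers an accepted
    first trial, and the last term yields \<open>\<alpha> * K \<le> c / 2\<close>. The summand 1
    keeps its denominator positive for \<open>K = 0\<close>.\<close>
  define abar where "abar = min (min 1 (ainit A)) (c / (2 * (K + 1)))"
  have "c > 0"
    using assms(16,17,24) by (simp add: c_def)
  have "K \<ge> 0"
    using \<open>C \<ge> 0\<close> G(1) lipschitz_on_nonneg[OF L] assms(6) by (simp add: K_def)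
  have dirs: "d \<in> tangent_space (man P) x"
      "grad P x \<bullet> d + hreg P (x + d) - hreg P x \<le> - c * (norm d)\<^sup>2"
    if "tmin A \<le> t" "t \<le> tmax A" "x \<in> man P" "search_dir P A t x d st" for t x d st
    using search_dir_properties[OF T[OF that(3)] assms(4)[OF that(3)] assms(11)[OF _ that(3)]
        _ that(2) _ that(4)] that(1) assms(6,16)
    unfolding c_def by auto
  have descent: "suff_descent P \<rho>1 x d \<alpha>"
    if sd: "tmin A \<le> t" "t \<le> tmax A" "x \<in> man P" "search_dir P A t x d st"
      and \<alpha>: "0 < \<alpha>" "\<alpha> < abar" for t x d st \<alpha>
  proof -
    have Td: "\<alpha> *\<^sub>R d \<in> tangent_space (man P) x"
      using dirs(1)[OF sd] T[OF sd(3)] by (simp add: subspace_scale)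
    have \<alpha>': "0 \<le> \<alpha>" "\<alpha> \<le> 1" and "\<alpha> * (2 * (K + 1)) < c"
      using \<alpha> \<open>K \<ge> 0\<close> by (auto simp: abar_def pos_less_divide_eq)
    then have "\<alpha> * K \<le> c / 2"
      by (simp add: algebra_simps)
    then have "(\<alpha> * K) * (\<alpha> * (norm d)\<^sup>2) \<le> (c / 2) * (\<alpha> * (norm d)\<^sup>2)"
      using \<alpha> by (intro mult_right_mono) auto
    moreover have "\<rho>1 * (\<alpha> * (norm d)\<^sup>2) \<le> (c / 2) * (\<alpha> * (norm d)\<^sup>2)"
      using \<alpha> by (intro mult_right_mono) (auto simp: \<rho>1_def)
    moreover have "\<alpha> * (grad P x \<bullet> d + hreg P (x + d) - hreg P x) \<le> \<alpha> * (- c * (norm d)\<^sup>2)"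
      using dirs(2)[OF sd] \<alpha>' by (intro mult_left_mono)
    moreover have "Fobj P (retr P x (\<alpha> *\<^sub>R d)) \<le> Fobj P x
        + \<alpha> * (grad P x \<bullet> d + hreg P (x + d) - hreg P x) + K * (\<alpha> * norm d)\<^sup>2"
      unfolding K_def using R2[OF sd(3) Td] R1[OF sd(3) Td] G(2)[OF sd(3)] \<alpha>' assms(6)
      by (intro Fobj_retr_le[OF assms(7) L]) auto
    ultimately show ?thesis
      by (simp add: suff_descent_def power2_eq_square algebra_simps)
  qed
  \<comment> \<open>Feasibility holds for every \<alpha>, which covers both full and backtracked
    steps in the invariant.\<close>
  have maps: "retr P x (\<alpha> *\<^sub>R d) \<in> man P"
    if "tmin A \<le> t" "t \<le> tmax A" "x \<in> man P" "search_dir P A t x d st" for t x d st \<alpha>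
    using dirs(1)[OF that] T[OF that(3)] that(3) assms(5)
    by (simp add: manifold_retraction_def subspace_scale)
  have inv: "rpn_inv P A s" if "rpn_reachable P A \<rho>1 x0 t0 s" for s
    by (rule rpn_reachable_inv[OF that assms(12,18,19,16,20,22) maps])
  show ?thesis
  proof (rule exI[of _ abar], rule exI[of _ \<rho>1], intro conjI allI impI)
    show "abar > 0" "0 < \<rho>1" "\<rho>1 < 1"
      using \<open>c > 0\<close> \<open>K \<ge> 0\<close> assms(13) by (auto simp: abar_def \<rho>1_def)
  next
    fix s d st \<alpha>
    assume s: "rpn_reachable P A \<rho>1 x0 t0 s"
      and sd: "search_dir P A (ts s (idx s)) (xs s (idx s)) d st" and \<alpha>: "0 < \<alpha> \<and> \<alpha> < abar"
    have "suff_descent P \<rho>1 (xs s (idx s)) d \<alpha>"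
      using inv[OF s] \<alpha> by (intro descent[OF _ _ _ sd]) (auto simp: rpn_inv_def)
    then show "Fobj P (retr P (xs s (idx s)) (\<alpha> *\<^sub>R d))
        \<le> Fobj P (xs s (idx s)) - \<alpha> * \<rho>1 * (norm d)\<^sup>2"
      by (simp add: suff_descent_def)
  next
    fix s \<alpha> s'
    assume "rpn_reachable P A \<rho>1 x0 t0 s" and "rpn_step P A \<rho>1 s (Some \<alpha>) s'"
    then obtain t x d st where sd: "tmin A \<le> t" "t \<le> tmax A" "x \<in> man P" "search_dir P A t x d st"
      and "backtrack P A \<rho>1 x d \<alpha>"
      using rpn_step_backtrack inv by metis
    moreover have "abar \<le> ainit A"
      by (simp add: abar_def)
    ultimately show "\<alpha> \<ge> abar * rho2 A"
      using backtrack_lower_bound[OF _ assms(13-15) _ descent[OF sd]] by blast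
  qed
qed

end
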